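(* Let $d$ be a positive integer, let $\varepsilon>0$, and set $$c=c(d,\varepsilon):= 2^{-16}\,\varepsilon^{4/(d+1)},\qquad n_0=n_0(d,\varepsilon):= 2^{20(d+1)^2}\varepsilon^{-(d+5)}.$$ Then for every integer $n\geq n_0$ there exists a subset $N$ of $[n]$ with $|N|\geq c \sqrt[d+1]{n}$ and satisfying the following property. If $\boldsymbol{X}= \langle X_s:s\in \binom{[n]}{d}\rangle$ is a real-valued, spreadable, $d$-dimensional random array on $[n]$ such that $\|X_s\|_{L_2}=1$ for all $s\in \binom{[n]}{d}$, then there exists a real-valued stochastic process $\boldsymbol{\Delta}=\langle \Delta_p : p\in \mathrm{PartIncr}([d],N)\rangle$ such that the following hold true. (i) (Decomposition) For every $s\in \binom{N}{d}$ we have $X_s=\sum_{F\subseteq [d]} \Delta_{\mathrm{I}_{s}\upharpoonright F}$. (ii) (Approximate zero mean) If $p\in \mathrm{PartIncr}([d],N)$ with $p\neq\emptyset$, then $\big|\mathbb{E}[\Delta_p]\big|\leq \varepsilon$. (iii) (Approximate orthogonality) If $p_1,p_2\in \mathrm{PartIncr}([d],N)$ are distinct and the pair $\{p_1,p_2\}$ is aligned, then $\big|\mathbb{E}[ \Delta_{p_1} \Delta_{p_2}]\big| \leq \varepsilon$. (iv) (Uniqueness) The process $\boldsymbol{\Delta}$ is unique in the following sense. There exists a subset $L$ of $N$ with $|L|\geq \big((\varepsilon^{-1}+2^{2d})d\big)^{-1} |N|$ such that for every real-valued stochastic process $\boldsymbol{Z}=\langle Z_p : p\in \mathrm{PartIncr}([d],N)\rangle$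 that satisfies (i) and (iii) above (with $\boldsymbol{Z}$ in place of $\boldsymbol{\Delta}$), we have $\|\Delta_p - Z_p\|_{L_2} \leq 2^{\binom{d+2}{2}} \sqrt{2\varepsilon}$ for all $p\in \mathrm{PartIncr}([d],L)$.
   Context: Notation: $\mathbb{N}=\{1,2,\dots\}$, $[n]=\{1,\dots,n\}$, and $\binom{I}{d}$ is the set of all $d$-element subsets of $I$. A $d$-dimensional random array on a set $I$ with $|I|\geq d$ is a stochastic process $\boldsymbol{X}=\langle X_s:s\in\binom{I}{d}\rangle$. For $I\subseteq\mathbb{N}$ it is spreadable if for all finite $J,K\subseteq I$ with $|J|=|K|\geq d$ the subarrays $\langle X_s:s\in\binom{J}{d}\rangle$ and $\langle X_s:s\in\binom{K}{d}\rangle$ have the same distribution (identifying $J$ and $K$ via the unique increasing bijection). For $F,L\subseteq\mathbb{N}$, $\mathrm{PartIncr}(F,L)$ is the set of strictly increasing partial maps $p$ with domain $\mathrm{dom}(p)\subseteq F$ and image contained in $L$; the empty partial map $\emptyset$ is included. For $G\subseteq\mathrm{dom}(p)$, $p\upharpoonright G$ is the restriction of $p$ to $G$. For distinct $p_1,p_2\in\mathrm{PartIncr}(F,L)$, the pair $\{p_1,p_2\}$ is aligned if there is a (possibly empty) set $G\subseteq\mathrm{dom}(p_1)\cap\mathrm{dom}(p_2)$ with $p_1\upharpoonright G=p_2\upharpoonright G$ and $p_1(\mathrm{dom}(p_1)\setminus G)\cap p_2(\mathrm{dom}(p_2)\setminus G)=\emptyset$. For a nonempty finite $s=\{i_1<\dots<i_\ell\}\subseteq\mathbb{N}$,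 the canonical isomorphism $\mathrm{I}_s\colon[\ell]\to s$ is $\mathrm{I}_s(j)=i_j$.
   Formalization: For ε>1 only, it is also assumed that c·n^{1/(d+1)} ≤ n and n ≥ 2d−1 (the claim fails otherwise, e.g. d=1, ε=2^20, n=1); N is uniform over arrays on each fixed sample set, and one N for all follows via a finite disjoint union of sample sets. *)

theory Defs
  imports "HOL-Probability.Probability" "HOL-Library.Ramsey"
begin

text \<open>
  Conventions: \<open>nsets I d\<close> is the set of all \<open>d\<close>-element subsets of \<open>I\<close>, and partial maps on
  \<open>\<nat>\<close> have type \<open>nat \<rightharpoonup> nat\<close>; restriction is \<open>p |` G\<close>.  The set \<open>[n]\<close> is \<open>{1..n}\<close>.
\<close>

definition real_process :: "'a measure \<Rightarrow> 'i set \<Rightarrow> ('i \<Rightarrow> 'a \<Rightarrow> real) \<Rightarrow> bool" where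
  "real_process M T X \<longleftrightarrow> (\<forall>t\<in>T. X t \<in> borel_measurable M)"

definition random_array :: "'a measure \<Rightarrow> nat \<Rightarrow> 'i set \<Rightarrow> ('i set \<Rightarrow> 'a \<Rightarrow> real) \<Rightarrow> bool" where
  "random_array M d I X \<longleftrightarrow> (finite I \<longrightarrow> d \<le> card I) \<and> real_process M (nsets I d) X"

text \<open>
  The order isomorphism \<open>\<phi>\<close> from \<open>J\<close> to \<open>K\<close> transports the subarray on \<open>K\<close> to one indexed by
  \<open>nsets J d\<close>, so that both joint laws live on the same product space.
\<close>

definition spreadable :: "'a measure \<Rightarrow> nat \<Rightarrow> nat set \<Rightarrow> (nat set \<Rightarrow> 'a \<Rightarrow> real) \<Rightarrow> bool" where
  "spreadable M d I X \<longleftrightarrow>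
     (\<forall>J K \<phi>. J \<subseteq> I \<and> K \<subseteq> I \<and> finite J \<and> finite K \<and> card J = card K \<and> d \<le> card J \<and>
        strict_mono_on J \<phi> \<and> \<phi> ` J = K \<longrightarrow>
        distr M (Pi\<^sub>M (nsets J d) (\<lambda>_. borel)) (\<lambda>\<omega>. \<lambda>s\<in>nsets J d. X s \<omega>) =
        distr M (Pi\<^sub>M (nsets J d) (\<lambda>_. borel)) (\<lambda>\<omega>. \<lambda>s\<in>nsets J d. X (\<phi> ` s) \<omega>))"

definition square_integrable :: "'a measure \<Rightarrow> ('a \<Rightarrow> real) \<Rightarrow> bool" where
  "square_integrable M f \<longleftrightarrow> f \<in> borel_measurable M \<and> integrable M (\<lambda>\<omega>. (f \<omega>)\<^sup>2)"

text \<open>Meaningful only together with \<open>square_integrable M f\<close>, since the integral of a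
  non-integrable function is \<open>0\<close>.\<close>

definition L2_norm :: "'a measure \<Rightarrow> ('a \<Rightarrow> real) \<Rightarrow> real" where
  "L2_norm M f = sqrt (\<integral>\<omega>. (f \<omega>)\<^sup>2 \<partial>M)"

definition part_incr :: "nat set \<Rightarrow> nat set \<Rightarrow> (nat \<rightharpoonup> nat) set" where
  "part_incr F L = {p. dom p \<subseteq> F \<and> ran p \<subseteq> L \<and> strict_mono_on (dom p) (the \<circ> p)}"

text \<open>The image of \<open>dom p - G\<close> under \<open>p\<close> is \<open>ran (p |` (dom p - G))\<close>.\<close>

definition aligned :: "(nat \<rightharpoonup> nat) \<Rightarrow> (nat \<rightharpoonup> nat) \<Rightarrow> bool" where
  "aligned p q \<longleftrightarrow>
     (\<exists>G \<subseteq> dom p \<inter> dom q. p |` G = q |` G \<and>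
        ran (p |` (dom p - G)) \<inter> ran (q |` (dom q - G)) = {})"

definition canon_iso :: "nat set \<Rightarrow> nat \<rightharpoonup> nat" where
  "canon_iso s = (\<lambda>j. if j \<in> {1..card s} then Some (sorted_list_of_set s ! (j - 1)) else None)"

definition c_const :: "nat \<Rightarrow> real \<Rightarrow> real" where
  "c_const d \<epsilon> = 2 powr (-16) * \<epsilon> powr (4 / real (d + 1))"

definition n0_const :: "nat \<Rightarrow> real \<Rightarrow> real" where
  "n0_const d \<epsilon> = 2 ^ (20 * (d + 1)\<^sup>2) * \<epsilon> powr (- real (d + 5))"

definition decomposition ::
  "'a measure \<Rightarrow> nat \<Rightarrow> nat set \<Rightarrow> (nat set \<Rightarrow> 'a \<Rightarrow> real) \<Rightarrow> ((nat \<rightharpoonup> nat) \<Rightarrow> 'a \<Rightarrow> real) \<Rightarrow> bool" where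
  "decomposition M d N X \<Delta> \<longleftrightarrow>
     (\<forall>s\<in>nsets N d. AE \<omega> in M. X s \<omega> = (\<Sum>F\<in>Pow {1..d}. \<Delta> (canon_iso s |` F) \<omega>))"

text \<open>
  In the next two definitions the existence of the expectations is made explicit:
  a bound on an expectation presupposes that it exists.
\<close>

definition approx_zero_mean ::
  "'a measure \<Rightarrow> nat \<Rightarrow> nat set \<Rightarrow> real \<Rightarrow> ((nat \<rightharpoonup> nat) \<Rightarrow> 'a \<Rightarrow> real) \<Rightarrow> bool" where
  "approx_zero_mean M d N \<epsilon> \<Delta> \<longleftrightarrow>
     (\<forall>p\<in>part_incr {1..d} N. p \<noteq> Map.empty \<longrightarrow>
        integrable M (\<Delta> p) \<and> \<bar>\<integral>\<omega>. \<Delta> p \<omega> \<partial>M\<bar> \<le> \<epsilon>)"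

definition approx_orthogonal ::
  "'a measure \<Rightarrow> nat \<Rightarrow> nat set \<Rightarrow> real \<Rightarrow> ((nat \<rightharpoonup> nat) \<Rightarrow> 'a \<Rightarrow> real) \<Rightarrow> bool" where
  "approx_orthogonal M d N \<epsilon> \<Delta> \<longleftrightarrow>
     (\<forall>p\<in>part_incr {1..d} N. \<forall>q\<in>part_incr {1..d} N. p \<noteq> q \<and> aligned p q \<longrightarrow>
        integrable M (\<lambda>\<omega>. \<Delta> p \<omega> * \<Delta> q \<omega>) \<and> \<bar>\<integral>\<omega>. \<Delta> p \<omega> * \<Delta> q \<omega> \<partial>M\<bar> \<le> \<epsilon>)"

end

theory Submission
  imports Defs
begin

text \<open>The array is only spreadable, but second moments see more symmetry: if the indices of \<open>s\<close> and \<open>t\<close>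
are far apart, then the expectation of \<open>X\<^sub>s X\<^sub>t\<close> is nearly determined by the pattern of coincidences
between \<open>s\<close> and \<open>t\<close>, not by their order type.  Indeed, let one index of \<open>s\<close> that does not
lie in \<open>t\<close> run through a block of \<open>k\<close> consecutive integers.  Spreadability makes the correlations
between any two of the resulting variables equal, and so the sum of the variables over one block differs
from the sum over another block only by \<open>O(\<surd>k)\<close> in \<open>L\<^sub>2\<close>.  Since the correlation with \<open>X\<^sub>t\<close> is constant along
each block, jumping over indices of \<open>t\<close> changes it by at most \<open>2 / \<surd>k\<close> (\<open>moment_move_one\<close>), and
\<open>moment_move\<close> iterates this over the coordinates.

The components come from Moebius inversion.  Take \<open>N\<close> to be a very sparse set of multiples of \<open>k\<close>.
Every partial map \<open>p\<close> into \<open>N\<close> has \<open>k\<close> extensions to a \<open>d\<close>-set whose additional indices lie on the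
grid between the points of \<open>N\<close> and are pairwise disjoint; the average of \<open>X\<close> over these extensions plays the
role of the conditional expectation of \<open>X\<close> given the indices in the image of \<open>p\<close>.  The component at \<open>p\<close>
is the alternating sum of these averages over all restrictions of \<open>p\<close>.  The decomposition is then an identity (\<open>sum_alt_sum\<close>), and
the nonempty components have mean zero because all averages have the same mean.  If \<open>p\<close> takes a value that
\<open>q\<close> misses, splitting the alternating sum at that position exhibits the component at \<open>p\<close> as a sum of
differences that are nearly orthogonal to every average belonging to \<open>q\<close>, as the coincidence patterns
agree for all but \<open>k\<close> of the \<open>k\<^sup>2\<close> pairs of extensions (\<open>component_orthogonal\<close>).

For the uniqueness, let \<open>L\<close> be sparse in \<open>N\<close>, so that \<open>p\<close> into \<open>L\<close> has at least
\<open>(1 / \<epsilon> + 4 ^ d) / 4\<close> extensions into \<open>N\<close> with disjoint additional indices.  Averaging the decomposition over them, every term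
that involves an additional index averages out by approximate orthogonality
(\<open>average_close\<close>).  Hence the sum of \<open>Z\<close> over the restrictions of \<open>p\<close> is close to an average of \<open>X\<close>, which does
not involve \<open>Z\<close>; Moebius inversion then recovers \<open>Z\<close> itself (\<open>approx_decomposition_unique\<close>).

For \<open>\<epsilon> > 1\<close> all correlations are at most \<open>\<epsilon>\<close>, and it suffices to put the whole of \<open>X\<close> into the
components with domain \<open>{1..d}\<close>.\<close>

section \<open>Alternating sums over subsets\<close>

text \<open>The Moebius transform on the lattice of subsets: the inverse of summation over
all subsets.\<close>

definition alt_sum :: "('i set \<Rightarrow> real) \<Rightarrow> 'i set \<Rightarrow> real" where
  "alt_sum y F = (\<Sum>G\<in>Pow F. (-1) ^ card (F - G) * y G)"

lemma sum_Pow_insert: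
  fixes h :: "'i set \<Rightarrow> 'b::comm_monoid_add"
  assumes "finite F" "x \<notin> F"
  shows "(\<Sum>G\<in>Pow (insert x F). h G) = (\<Sum>G\<in>Pow F. h G) + (\<Sum>G\<in>Pow F. h (insert x G))"
proof -
  have inj: "inj_on (insert x) (Pow F)"
  proof (rule inj_onI)
    fix G H assume "G \<in> Pow F" "H \<in> Pow F" "insert x G = insert x H"
    moreover from this have "x \<notin> G" "x \<notin> H" using assms(2) by auto
    ultimately show "G = H" by (simp add: insert_ident)
  qed
  have "(\<Sum>G\<in>Pow (insert x F). h G) = (\<Sum>G\<in>Pow F. h G) + (\<Sum>G\<in>insert x ` Pow F. h G)"
    unfolding Pow_insert using assms by (intro sum.union_disjoint) auto
  then show ?thesis using inj by (simp add: sum.reindex)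
qed

text \<open>The subsets with and without \<open>x\<close> carry opposite signs, so an alternating sum is one
over differences.  All cancellation in the components of the decomposition comes from here.\<close>

lemma alt_sum_insert:
  assumes "finite F" "x \<notin> F"
  shows "alt_sum y (insert x F) = alt_sum (\<lambda>G. y (insert x G) - y G) F"
proof -
  have 1: "card (insert x F - G) = Suc (card (F - G))" if "G \<subseteq> F" for G
  proof -
    have "insert x F - G = insert x (F - G)" using that assms(2) by auto
    then show ?thesis using assms by simp
  qed
  have "alt_sum y (insert x F)
      = (\<Sum>G\<in>Pow F. (-1) ^ card (insert x F - G) * y G)
        + (\<Sum>G\<in>Pow F. (-1) ^ card (insert x F - insert x G) * y (insert x G))"
    unfolding alt_sum_def using assms by (rule sum_Pow_insert)
  also have "\<dots> = (\<Sum>G\<in>Pow F. - ((-1) ^ card (F - G) * y G))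
        + (\<Sum>G\<in>Pow F. (-1) ^ card (F - G) * y (insert x G))"
    using assms(2) by (intro arg_cong2[where f="(+)"] sum.cong) (simp_all add: 1 Diff_insert0)
  also have "\<dots> = alt_sum (\<lambda>G. y (insert x G) - y G) F"
    unfolding alt_sum_def by (simp add: sum_negf sum_subtractf right_diff_distrib)
  finally show ?thesis .
qed

lemma alt_sum_cong:
  assumes "\<And>G. G \<subseteq> F \<Longrightarrow> y G = z G"
  shows "alt_sum y F = alt_sum z F"
  unfolding alt_sum_def by (intro sum.cong) (auto simp: assms)

lemma alt_sum_diff: "alt_sum (\<lambda>G. y G - z G) F = alt_sum y F - alt_sum z F"
  unfolding alt_sum_def by (simp add: right_diff_distrib sum_subtractf)

text \<open>The two halves of Moebius inversion.  The first one gives the decomposition of the array, the second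
one recovers a decomposing process from its sums over restrictions.\<close>

lemma sum_alt_sum:
  assumes "finite D"
  shows "(\<Sum>F\<in>Pow D. alt_sum y F) = y D"
proof -
  have "y D = (\<Sum>F\<in>Pow D. (-1) ^ card F * (\<Sum>G\<in>Pow F. (-1) ^ card G * y G))"
    using assms by (rule inclusion_exclusion_symmetric[OF refl])
  also have "\<dots> = (\<Sum>F\<in>Pow D. alt_sum y F)"
    unfolding alt_sum_def sum_distrib_left
  proof (intro sum.cong refl)
    fix F G assume "F \<in> Pow D" "G \<in> Pow F"
    then have "finite F" "G \<subseteq> F" using assms finite_subset by auto
    then have "card (F - G) + 2 * card G = card F + card G"
      using card_mono[of F G] by (simp add: card_Diff_subset finite_subset)
    then have "(-1::real) ^ card (F - G) = (-1) ^ (card F + card G)"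
      by (metis (no_types, lifting) power_add power_mult mult.right_neutral power_minus1_even)
    then show "(-1) ^ card F * ((-1) ^ card G * y G) = (-1) ^ card (F - G) * y G"
      by (simp add: power_add)
  qed
  finally show ?thesis by simp
qed

lemma alt_sum_sum:
  assumes "finite D"
  shows "alt_sum (\<lambda>G. \<Sum>H\<in>Pow G. z H) D = z D"
proof -
  have "z D = (\<Sum>G\<in>Pow D. (-1) ^ (card D - card G) * (\<Sum>H\<in>Pow G. z H))"
    using assms by (rule inclusion_exclusion_mobius[OF refl])
  also have "\<dots> = (\<Sum>G\<in>Pow D. (-1) ^ card (D - G) * (\<Sum>H\<in>Pow G. z H))"
    by (intro sum.cong) (auto simp: card_Diff_subset finite_subset[OF _ assms])
  finally show ?thesis by (simp add: alt_sum_def)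
qed

section \<open>Second moments\<close>

definition L2_inner :: "'a measure \<Rightarrow> ('a \<Rightarrow> real) \<Rightarrow> ('a \<Rightarrow> real) \<Rightarrow> real" where
  "L2_inner M f g = (\<integral>\<omega>. f \<omega> * g \<omega> \<partial>M)"

lemma square_integrable_measurable: "square_integrable M f \<Longrightarrow> f \<in> borel_measurable M"
  by (simp add: square_integrable_def)

lemma square_integrable_mult:
  assumes "square_integrable M f" "square_integrable M g"
  shows "integrable M (\<lambda>\<omega>. f \<omega> * g \<omega>)"
proof (rule Bochner_Integration.integrable_bound)
  show "integrable M (\<lambda>\<omega>. (f \<omega>)\<^sup>2 + (g \<omega>)\<^sup>2)"
    using assms by (auto simp: square_integrable_def)
  have "norm (f \<omega> * g \<omega>) \<le> norm ((f \<omega>)\<^sup>2 + (g \<omega>)\<^sup>2)" for \<omega>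
  proof -
    have "0 \<le> (\<bar>f \<omega>\<bar> - \<bar>g \<omega>\<bar>)\<^sup>2" by simp
    then have "2 * (\<bar>f \<omega>\<bar> * \<bar>g \<omega>\<bar>) \<le> (f \<omega>)\<^sup>2 + (g \<omega>)\<^sup>2"
      by (simp add: power2_diff)
    moreover have "0 \<le> \<bar>f \<omega>\<bar> * \<bar>g \<omega>\<bar>" by simp
    ultimately show ?thesis unfolding real_norm_def abs_mult by linarith
  qed
  then show "AE \<omega> in M. norm (f \<omega> * g \<omega>) \<le> norm ((f \<omega>)\<^sup>2 + (g \<omega>)\<^sup>2)" by simp
  show "(\<lambda>\<omega>. f \<omega> * g \<omega>) \<in> borel_measurable M"
    using assms by (auto simp: square_integrable_def)
qed

lemma square_integrable_cmult:
  "square_integrable M f \<Longrightarrow> square_integrable M (\<lambda>\<omega>. c * f \<omega>)"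
  unfolding square_integrable_def power_mult_distrib
  by (intro conjI borel_measurable_times integrable_mult_right) simp_all

lemma square_integrable_add:
  assumes "square_integrable M f" "square_integrable M g"
  shows "square_integrable M (\<lambda>\<omega>. f \<omega> + g \<omega>)"
  unfolding square_integrable_def power2_sum
proof (intro conjI Bochner_Integration.integrable_add)
  show "integrable M (\<lambda>\<omega>. 2 * f \<omega> * g \<omega>)"
    using integrable_mult_right[OF square_integrable_mult[OF assms], of 2] by (simp only: mult.assoc)
qed (use assms in \<open>auto simp: square_integrable_def intro!: borel_measurable_add\<close>)

lemma square_integrable_diff:
  assumes "square_integrable M f" "square_integrable M g"
  shows "square_integrable M (\<lambda>\<omega>. f \<omega> - g \<omega>)"
  using square_integrable_add[OF assms(1) square_integrable_cmult[OF assms(2), of "-1"]] by simp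

lemma square_integrable_sum:
  assumes "\<And>i. i \<in> I \<Longrightarrow> square_integrable M (f i)"
  shows "square_integrable M (\<lambda>\<omega>. \<Sum>i\<in>I. f i \<omega>)"
  using assms
proof (induction I rule: infinite_finite_induct)
  case (insert i I)
  then show ?case by (simp add: square_integrable_add)
qed (simp_all add: square_integrable_def)

lemma L2_inner_commute: "L2_inner M f g = L2_inner M g f"
  by (simp add: L2_inner_def mult.commute)

lemma L2_inner_sum_left:
  assumes "\<And>i. i \<in> I \<Longrightarrow> square_integrable M (f i)" "square_integrable M g"
  shows "L2_inner M (\<lambda>\<omega>. \<Sum>i\<in>I. f i \<omega>) g = (\<Sum>i\<in>I. L2_inner M (f i) g)"
  unfolding L2_inner_def sum_distrib_right
  by (intro Bochner_Integration.integral_sum square_integrable_mult assms)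

lemma L2_inner_sum_right:
  assumes "\<And>i. i \<in> I \<Longrightarrow> square_integrable M (f i)" "square_integrable M g"
  shows "L2_inner M g (\<lambda>\<omega>. \<Sum>i\<in>I. f i \<omega>) = (\<Sum>i\<in>I. L2_inner M g (f i))"
  using L2_inner_sum_left[of I M f g] assms by (simp add: L2_inner_commute)

lemma L2_inner_cmult_left: "L2_inner M (\<lambda>\<omega>. c * f \<omega>) g = c * L2_inner M f g"
  by (simp add: L2_inner_def mult.assoc)

lemma L2_inner_cmult_right: "L2_inner M f (\<lambda>\<omega>. c * g \<omega>) = c * L2_inner M f g"
  by (simp add: L2_inner_def mult.left_commute)

lemma L2_inner_diff_left:
  assumes "square_integrable M f" "square_integrable M f'" "square_integrable M g"
  shows "L2_inner M (\<lambda>\<omega>. f \<omega> - f' \<omega>) g = L2_inner M f g - L2_inner M f' g"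
  unfolding L2_inner_def left_diff_distrib
  by (intro Bochner_Integration.integral_diff square_integrable_mult assms)

lemma L2_inner_diff_right:
  assumes "square_integrable M f" "square_integrable M f'" "square_integrable M g"
  shows "L2_inner M g (\<lambda>\<omega>. f \<omega> - f' \<omega>) = L2_inner M g f - L2_inner M g f'"
  using L2_inner_diff_left[OF assms] by (simp add: L2_inner_commute)

lemma L2_inner_self: "L2_inner M f f = (\<integral>\<omega>. (f \<omega>)\<^sup>2 \<partial>M)"
  by (simp add: L2_inner_def power2_eq_square)

lemma L2_inner_self_nonneg: "0 \<le> L2_inner M f f"
  by (simp add: L2_inner_def)

text \<open>The Cauchy--Schwarz inequality in its weighted arithmetic--geometric form, which follows from the
nonnegativity of the norm of \<open>c f \<plusminus> g\<close>.\<close>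

lemma abs_L2_inner_le:
  assumes "square_integrable M f" "square_integrable M g" "c > 0"
  shows "\<bar>L2_inner M f g\<bar> \<le> (c * L2_inner M f f + L2_inner M g g / c) / 2"
proof -
  have *: "0 \<le> c * L2_inner M f f - 2 * s * L2_inner M f g + L2_inner M g g / c" if s: "s = 1 \<or> s = - 1" for s :: real
  proof -
    have "0 \<le> L2_inner M (\<lambda>\<omega>. c * f \<omega> - s * g \<omega>) (\<lambda>\<omega>. c * f \<omega> - s * g \<omega>)" by (rule L2_inner_self_nonneg)
    also have "\<dots> = c * c * L2_inner M f f - 2 * s * c * L2_inner M f g + s * s * L2_inner M g g"
      using assms by (simp add: L2_inner_diff_left L2_inner_diff_right square_integrable_cmult
          square_integrable_diff L2_inner_cmult_left L2_inner_cmult_right L2_inner_commute[of M g f] algebra_simps)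
    also have "\<dots> = c * (c * L2_inner M f f - 2 * s * L2_inner M f g + L2_inner M g g / c)"
      using assms(3) s by (auto simp: algebra_simps)
    finally show ?thesis using assms(3) by (simp add: zero_le_mult_iff)
  qed
  show ?thesis using *[of 1] *[of "-1"] by (auto simp: abs_if)
qed

text \<open>An approximate theorem of Pythagoras: each off-diagonal term of the expanded square costs at
most \<open>\<epsilon>\<close>.\<close>

lemma L2_inner_sum_almost_orthogonal:
  assumes "finite I" "\<And>i. i \<in> I \<Longrightarrow> square_integrable M (f i)" "\<epsilon> \<ge> 0"
    and "\<And>i j. i \<in> I \<Longrightarrow> j \<in> I \<Longrightarrow> i \<noteq> j \<Longrightarrow> \<bar>L2_inner M (f i) (f j)\<bar> \<le> \<epsilon>"
  shows "\<bar>L2_inner M (\<lambda>\<omega>. \<Sum>i\<in>I. f i \<omega>) (\<lambda>\<omega>. \<Sum>i\<in>I. f i \<omega>) - (\<Sum>i\<in>I. L2_inner M (f i) (f i))\<bar>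
      \<le> (real (card I))\<^sup>2 * \<epsilon>"
proof -
  have "L2_inner M (\<lambda>\<omega>. \<Sum>i\<in>I. f i \<omega>) (\<lambda>\<omega>. \<Sum>i\<in>I. f i \<omega>) = (\<Sum>i\<in>I. \<Sum>j\<in>I. L2_inner M (f i) (f j))"
    using assms by (simp add: L2_inner_sum_left L2_inner_sum_right square_integrable_sum)
  also have "\<dots> - (\<Sum>i\<in>I. L2_inner M (f i) (f i))
      = (\<Sum>i\<in>I. \<Sum>j\<in>I. L2_inner M (f i) (f j) - (if i = j then L2_inner M (f i) (f i) else 0))"
    using assms(1) by (simp add: sum_subtractf)
  finally have "\<bar>L2_inner M (\<lambda>\<omega>. \<Sum>i\<in>I. f i \<omega>) (\<lambda>\<omega>. \<Sum>i\<in>I. f i \<omega>) - (\<Sum>i\<in>I. L2_inner M (f i) (f i))\<bar>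
      = \<bar>\<Sum>i\<in>I. \<Sum>j\<in>I. L2_inner M (f i) (f j) - (if i = j then L2_inner M (f i) (f i) else 0)\<bar>"
    by simp
  also have "\<dots> \<le> (\<Sum>i\<in>I. \<Sum>j\<in>I. \<bar>L2_inner M (f i) (f j) - (if i = j then L2_inner M (f i) (f i) else 0)\<bar>)"
    by (intro order.trans[OF sum_abs] sum_mono sum_abs)
  also have "\<dots> \<le> (\<Sum>i\<in>I. \<Sum>j\<in>I. \<epsilon>)"
    using assms by (intro sum_mono) auto
  also have "\<dots> = (real (card I))\<^sup>2 * \<epsilon>" by (simp add: power2_eq_square)
  finally show ?thesis .
qed

lemma L2_inner_cong_AE:
  assumes "f \<in> borel_measurable M" "f' \<in> borel_measurable M" "AE \<omega> in M. f \<omega> = f' \<omega>"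
  shows "L2_inner M f f = L2_inner M f' f'"
  unfolding L2_inner_def
proof (rule integral_cong_AE)
  show "AE \<omega> in M. f \<omega> * f \<omega> = f' \<omega> * f' \<omega>" using assms(3) by eventually_elim simp
qed (use assms in \<open>auto intro: borel_measurable_times\<close>)

text \<open>The square of the triangle inequality, with \<open>(a + b)\<^sup>2 \<le> 2 a\<^sup>2 + 2 b\<^sup>2\<close>.\<close>

lemma L2_inner_diff_self_le:
  assumes "square_integrable M f" "square_integrable M g"
  shows "L2_inner M (\<lambda>\<omega>. f \<omega> - g \<omega>) (\<lambda>\<omega>. f \<omega> - g \<omega>) \<le> 2 * (L2_inner M f f + L2_inner M g g)"
proof -
  have "L2_inner M (\<lambda>\<omega>. f \<omega> - g \<omega>) (\<lambda>\<omega>. f \<omega> - g \<omega>)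
      = L2_inner M f (\<lambda>\<omega>. f \<omega> - g \<omega>) - L2_inner M g (\<lambda>\<omega>. f \<omega> - g \<omega>)"
    using assms by (intro L2_inner_diff_left square_integrable_diff)
  also have "\<dots> = L2_inner M f f - L2_inner M f g - (L2_inner M g f - L2_inner M g g)"
    using assms by (simp only: L2_inner_diff_right)
  also have "\<dots> = L2_inner M f f - 2 * L2_inner M f g + L2_inner M g g"
    using L2_inner_commute[of M g f] by linarith
  finally show ?thesis using abs_L2_inner_le[OF assms, of 1] by simp
qed

lemma (in finite_measure) square_integrable_integrable:
  "square_integrable M f \<Longrightarrow> integrable M f"
  unfolding square_integrable_def by (elim conjE) (rule square_integrable_imp_integrable)

lemma abs_L2_inner_combination_le:
  assumes f: "\<And>a. a \<in> A \<Longrightarrow> square_integrable M (f a)" and g: "\<And>b. b \<in> B \<Longrightarrow> square_integrable M (g b)"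
    and s: "\<And>a. a \<in> A \<Longrightarrow> \<bar>s a\<bar> \<le> 1" and t: "\<And>b. b \<in> B \<Longrightarrow> \<bar>t b\<bar> \<le> 1"
    and c: "\<And>a b. a \<in> A \<Longrightarrow> b \<in> B \<Longrightarrow> \<bar>L2_inner M (f a) (g b)\<bar> \<le> c"
  shows "\<bar>L2_inner M (\<lambda>\<omega>. \<Sum>a\<in>A. s a * f a \<omega>) (\<lambda>\<omega>. \<Sum>b\<in>B. t b * g b \<omega>)\<bar>
      \<le> real (card A) * real (card B) * c"
proof -
  have "L2_inner M (\<lambda>\<omega>. \<Sum>a\<in>A. s a * f a \<omega>) (\<lambda>\<omega>. \<Sum>b\<in>B. t b * g b \<omega>)
      = (\<Sum>a\<in>A. L2_inner M (\<lambda>\<omega>. s a * f a \<omega>) (\<lambda>\<omega>. \<Sum>b\<in>B. t b * g b \<omega>))"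
    by (intro L2_inner_sum_left square_integrable_sum square_integrable_cmult f g)
  also have "\<dots> = (\<Sum>a\<in>A. \<Sum>b\<in>B. L2_inner M (\<lambda>\<omega>. s a * f a \<omega>) (\<lambda>\<omega>. t b * g b \<omega>))"
    by (intro sum.cong refl L2_inner_sum_right square_integrable_cmult f g)
  also have "\<dots> = (\<Sum>a\<in>A. \<Sum>b\<in>B. s a * (t b * L2_inner M (f a) (g b)))"
    by (simp only: L2_inner_cmult_left L2_inner_cmult_right)
  finally have "\<bar>L2_inner M (\<lambda>\<omega>. \<Sum>a\<in>A. s a * f a \<omega>) (\<lambda>\<omega>. \<Sum>b\<in>B. t b * g b \<omega>)\<bar>
      = \<bar>\<Sum>a\<in>A. \<Sum>b\<in>B. s a * (t b * L2_inner M (f a) (g b))\<bar>" by simp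
  also have "\<dots> \<le> (\<Sum>a\<in>A. \<Sum>b\<in>B. \<bar>s a * (t b * L2_inner M (f a) (g b))\<bar>)"
    by (intro order.trans[OF sum_abs] sum_mono sum_abs)
  also have "\<dots> \<le> (\<Sum>a\<in>A. \<Sum>b\<in>B. c)"
  proof (intro sum_mono)
    fix a b assume ab: "a \<in> A" "b \<in> B"
    have "\<bar>s a * (t b * L2_inner M (f a) (g b))\<bar> = \<bar>s a\<bar> * (\<bar>t b\<bar> * \<bar>L2_inner M (f a) (g b)\<bar>)"
      by (simp add: abs_mult)
    also have "\<dots> \<le> 1 * (1 * c)"
      using s[OF ab(1)] t[OF ab(2)] c[OF ab] by (intro mult_mono) auto
    finally show "\<bar>s a * (t b * L2_inner M (f a) (g b))\<bar> \<le> c" by simp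
  qed
  also have "\<dots> = real (card A) * real (card B) * c" by simp
  finally show ?thesis .
qed

section \<open>Pair moments of a spreadable array\<close>

text \<open>The coordinates are indexed by \<open>{1..d}\<close>; the numeral \<open>1\<close> must not become \<open>Suc 0\<close>.\<close>

declare One_nat_def [simp del]

text \<open>A \<open>d\<close>-element subset of \<open>A\<close> is handled through its increasing enumeration \<open>f\<close>, since both the
order type of a pair of sets and the replacement of a single index refer to coordinates.\<close>

definition incr :: "nat \<Rightarrow> nat set \<Rightarrow> (nat \<Rightarrow> nat) \<Rightarrow> bool" where
  "incr d A f \<longleftrightarrow> strict_mono_on {1..d} f \<and> f ` {1..d} \<subseteq> A"

lemma incr_less_iff: "incr d A f \<Longrightarrow> i \<in> {1..d} \<Longrightarrow> j \<in> {1..d} \<Longrightarrow> f i < f j \<longleftrightarrow> i < j"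
  unfolding incr_def using strict_mono_on_less[of "{1..d}" f i j] by simp

lemma incr_eq_iff: "incr d A f \<Longrightarrow> i \<in> {1..d} \<Longrightarrow> j \<in> {1..d} \<Longrightarrow> f i = f j \<longleftrightarrow> i = j"
  unfolding incr_def using strict_mono_on_eq[of "{1..d}" f i j] by simp

lemma incr_mem: "incr d A f \<Longrightarrow> i \<in> {1..d} \<Longrightarrow> f i \<in> A"
  unfolding incr_def by blast

lemma incr_mono: "incr d A f \<Longrightarrow> A \<subseteq> B \<Longrightarrow> incr d B f"
  unfolding incr_def by blast

lemma incr_inj: "incr d A f \<Longrightarrow> inj_on f {1..d}"
  by (auto simp: inj_on_def incr_eq_iff)

lemma incr_nsets: "incr d A f \<Longrightarrow> f ` {1..d} \<in> nsets A d"
  using incr_inj[of d A f] by (auto simp: nsets_def incr_def card_image)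

locale unit_spreadable_array = prob_space M for M :: "'a measure" +
  fixes d n :: nat and X :: "nat set \<Rightarrow> 'a \<Rightarrow> real"
  assumes d_pos: "1 \<le> d"
    and spread: "spreadable M d {1..n} X"
    and square_integrable_X: "s \<in> nsets {1..n} d \<Longrightarrow> square_integrable M (X s)"
    and norm_X: "s \<in> nsets {1..n} d \<Longrightarrow> L2_inner M (X s) (X s) = 1"
begin

definition moment :: "(nat \<Rightarrow> nat) \<Rightarrow> (nat \<Rightarrow> nat) \<Rightarrow> real" where
  "moment f g = L2_inner M (X (f ` {1..d})) (X (g ` {1..d}))"

lemma moment_commute: "moment f g = moment g f"
  by (simp add: moment_def L2_inner_commute)

lemma square_integrable_X_incr: "incr d {1..n} f \<Longrightarrow> square_integrable M (X (f ` {1..d}))"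
  by (intro square_integrable_X incr_nsets)

lemma moment_self: "incr d {1..n} f \<Longrightarrow> moment f f = 1"
  unfolding moment_def by (intro norm_X incr_nsets)

lemma abs_moment_le_1: "incr d {1..n} f \<Longrightarrow> incr d {1..n} g \<Longrightarrow> \<bar>moment f g\<bar> \<le> 1"
  using abs_L2_inner_le[of M "X (f ` {1..d})" "X (g ` {1..d})" 1] moment_self[of f] moment_self[of g]
  by (simp add: moment_def square_integrable_X_incr)

text \<open>Equality of the two joint laws, tested against a function \<open>h\<close> of the subarray.\<close>

lemma spread_transport:
  fixes h :: "(nat set \<Rightarrow> real) \<Rightarrow> real"
  assumes J: "J \<subseteq> {1..n}" "d \<le> card J" "strict_mono_on J \<phi>" "\<phi> ` J \<subseteq> {1..n}"
    and h: "h \<in> borel_measurable (Pi\<^sub>M (nsets J d) (\<lambda>_. borel))"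
  shows "(\<integral>\<omega>. h (\<lambda>s\<in>nsets J d. X s \<omega>) \<partial>M) = (\<integral>\<omega>. h (\<lambda>s\<in>nsets J d. X (\<phi> ` s) \<omega>) \<partial>M)"
proof -
  let ?P = "Pi\<^sub>M (nsets J d) (\<lambda>_. borel :: real measure)"
  have inj: "inj_on \<phi> J" using J(3) by (rule strict_mono_on_imp_inj_on)
  have fin: "finite J" using J(1) finite_subset by blast
  have eq: "distr M ?P (\<lambda>\<omega>. \<lambda>s\<in>nsets J d. X s \<omega>) = distr M ?P (\<lambda>\<omega>. \<lambda>s\<in>nsets J d. X (\<phi> ` s) \<omega>)"
    using spread J fin inj unfolding spreadable_def by (auto simp: card_image)
  have m1: "(\<lambda>\<omega>. \<lambda>s\<in>nsets J d. X s \<omega>) \<in> measurable M ?P"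
  proof (rule measurable_restrict)
    fix s assume "s \<in> nsets J d"
    then have "s \<in> nsets {1..n} d" using J(1) by (auto simp: nsets_def)
    then show "X s \<in> borel_measurable M" by (intro square_integrable_measurable square_integrable_X)
  qed
  have m2: "(\<lambda>\<omega>. \<lambda>s\<in>nsets J d. X (\<phi> ` s) \<omega>) \<in> measurable M ?P"
  proof (rule measurable_restrict)
    fix s assume "s \<in> nsets J d"
    then have "\<phi> ` s \<in> nsets {1..n} d"
      using J(4) inj by (auto simp: nsets_def card_image inj_on_subset)
    then show "X (\<phi> ` s) \<in> borel_measurable M"
      by (intro square_integrable_measurable square_integrable_X)
  qed
  show ?thesis
    unfolding integral_distr[OF m1 h, symmetric] integral_distr[OF m2 h, symmetric] eq by (rule refl)
qed

text \<open>Matching \<open>f\<close> with \<open>f'\<close> and \<open>g\<close> with \<open>g'\<close> defines a strictly increasing map on the union of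
the two index sets exactly when the relative order of the coordinates is the same.\<close>

lemma moment_order_type:
  assumes f: "incr d {1..n} f" "incr d {1..n} f'" and g: "incr d {1..n} g" "incr d {1..n} g'"
    and less: "\<And>i j. i \<in> {1..d} \<Longrightarrow> j \<in> {1..d} \<Longrightarrow> f i < g j \<longleftrightarrow> f' i < g' j"
    and eq: "\<And>i j. i \<in> {1..d} \<Longrightarrow> j \<in> {1..d} \<Longrightarrow> f i = g j \<longleftrightarrow> f' i = g' j"
  shows "moment f g = moment f' g'"
proof -
  define J where "J = f ` {1..d} \<union> g ` {1..d}"
  define \<phi> where "\<phi> x = (if x \<in> f ` {1..d} then f' (the_inv_into {1..d} f x)
      else g' (the_inv_into {1..d} g x))" for x
  have \<phi>f: "\<phi> (f i) = f' i" if "i \<in> {1..d}" for i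
    using that incr_inj[OF f(1)] by (simp add: \<phi>_def the_inv_into_f_f)
  have \<phi>g: "\<phi> (g j) = g' j" if j: "j \<in> {1..d}" for j
  proof (cases "g j \<in> f ` {1..d}")
    case True
    then obtain i where i: "i \<in> {1..d}" "g j = f i" by auto
    with eq[OF i(1) j] show ?thesis by (simp add: \<phi>f)
  next
    case False
    then show ?thesis using j incr_inj[OF g(1)] by (simp add: \<phi>_def the_inv_into_f_f)
  qed
  have greater: "g j < f i \<longleftrightarrow> g' j < f' i" if "i \<in> {1..d}" "j \<in> {1..d}" for i j
    using less[OF that] eq[OF that] by linarith
  have mono: "strict_mono_on J \<phi>"
  proof (rule strict_mono_onI)
    fix x y assume "x \<in> J" "y \<in> J" "x < y"
    then consider i j where "i \<in> {1..d}" "j \<in> {1..d}" "x = f i" "y = f j"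
      | i j where "i \<in> {1..d}" "j \<in> {1..d}" "x = f i" "y = g j"
      | i j where "i \<in> {1..d}" "j \<in> {1..d}" "x = g i" "y = f j"
      | i j where "i \<in> {1..d}" "j \<in> {1..d}" "x = g i" "y = g j"
      unfolding J_def by blast
    then show "\<phi> x < \<phi> y"
    proof cases
      case 1
      with \<open>x < y\<close> show ?thesis by (simp add: \<phi>f incr_less_iff[OF f(1)] incr_less_iff[OF f(2)])
    next
      case 2
      with \<open>x < y\<close> show ?thesis by (simp add: \<phi>f \<phi>g less)
    next
      case 3
      with \<open>x < y\<close> show ?thesis by (simp add: \<phi>f \<phi>g greater)
    next
      case 4
      with \<open>x < y\<close> show ?thesis by (simp add: \<phi>g incr_less_iff[OF g(1)] incr_less_iff[OF g(2)])
    qed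
  qed
  have im: "\<phi> ` f ` {1..d} = f' ` {1..d}" "\<phi> ` g ` {1..d} = g' ` {1..d}"
    by (auto simp: image_image \<phi>f \<phi>g intro!: image_cong)
  have J: "J \<subseteq> {1..n}" "\<phi> ` J \<subseteq> {1..n}"
    using f g im by (auto simp: J_def image_Un incr_def)
  have mem: "f ` {1..d} \<in> nsets J d" "g ` {1..d} \<in> nsets J d"
    using incr_nsets[of d J f] incr_nsets[of d J g] f g by (auto simp: incr_def J_def)
  have "finite J" by (simp add: J_def)
  then have "d \<le> card J"
    using mem(1) card_mono[of J "f ` {1..d}"] by (simp add: nsets_def)
  from spread_transport[OF J(1) this mono J(2),
      where h="\<lambda>x. x (f ` {1..d}) * x (g ` {1..d})"] mem im
  show ?thesis by (simp add: moment_def L2_inner_def)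
qed

lemma mean_eq:
  assumes f: "incr d {1..n} f" "incr d {1..n} f'"
  shows "(\<integral>\<omega>. X (f ` {1..d}) \<omega> \<partial>M) = (\<integral>\<omega>. X (f' ` {1..d}) \<omega> \<partial>M)"
proof -
  define \<phi> where "\<phi> x = f' (the_inv_into {1..d} f x)" for x
  have \<phi>f: "\<phi> (f i) = f' i" if "i \<in> {1..d}" for i
    using that incr_inj[OF f(1)] by (simp add: \<phi>_def the_inv_into_f_f)
  have mono: "strict_mono_on (f ` {1..d}) \<phi>"
    by (rule strict_mono_onI)
      (auto simp: \<phi>f incr_less_iff[OF f(1)] incr_less_iff[OF f(2)])
  have im: "\<phi> ` f ` {1..d} = f' ` {1..d}"
    by (auto simp: image_image \<phi>f intro!: image_cong)
  have mem: "f ` {1..d} \<in> nsets (f ` {1..d}) d"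
    using incr_inj[OF f(1)] by (simp add: nsets_def card_image)
  have "f ` {1..d} \<subseteq> {1..n}" "\<phi> ` f ` {1..d} \<subseteq> {1..n}" "d \<le> card (f ` {1..d})"
    using f im mem by (auto simp: incr_def nsets_def)
  from spread_transport[OF this(1) this(3) mono this(2), where h="\<lambda>x. x (f ` {1..d})"] mem im
  show ?thesis by simp
qed

end

subsection \<open>Moving indices on a coarse grid\<close>

text \<open>Each grid point \<open>x\<close> opens a block \<open>{x..<x + k}\<close> that stays below \<open>n\<close> and contains no other grid point,
so an index can move within its block without passing another index on the grid.\<close>

definition grid :: "nat \<Rightarrow> nat \<Rightarrow> nat set" where
  "grid n k = {x. k dvd x \<and> 1 \<le> x \<and> x + k \<le> Suc n}"

lemma dvd_block_less:
  fixes a b x k :: nat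
  assumes "k dvd a" "k dvd b" "a \<noteq> b" "b \<le> x" "x < b + k"
  shows "a < x \<longleftrightarrow> a < b" "x < a \<longleftrightarrow> b < a" "x \<noteq> a"
proof -
  have "b + k \<le> a" if "b < a"
  proof -
    have "k dvd a - b" using assms by simp
    with that have "k \<le> a - b" by (intro dvd_imp_le) auto
    with that show ?thesis by simp
  qed
  with assms show "a < x \<longleftrightarrow> a < b" "x < a \<longleftrightarrow> b < a" "x \<noteq> a" by linarith+
qed

lemma grid_subset: "k > 0 \<Longrightarrow> grid n k \<subseteq> {1..n}"
  by (auto simp: grid_def)

context unit_spreadable_array
begin

text \<open>Let \<open>a\<^sub>x\<close> be the variable with index \<open>x\<close> in place \<open>j\<close>.  For \<open>x\<close> in the blocks of \<open>u = f j\<close> and of \<open>u'\<close>, the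
correlation of two different \<open>a\<^sub>x\<close> is a constant \<open>\<rho>\<close>, as no other index of \<open>f\<close> separates them.
Hence the differences \<open>a\<^bsub>u+i\<^esub> - a\<^bsub>u'+i\<^esub>\<close> are orthogonal for distinct \<open>i\<close>, their sum has squared norm at most
\<open>4 k\<close>, while its correlation with the variable of \<open>g\<close> is \<open>k\<close> times the change to be estimated.\<close>

lemma moment_move_one:
  assumes k: "k > 0"
    and f: "incr d (grid n k) f" and f': "incr d (grid n k) (f(j := u'))" and g: "incr d (grid n k) g"
    and j: "j \<in> {1..d}" and ng: "f j \<notin> g ` {1..d}" "u' \<notin> g ` {1..d}"
  shows "\<bar>moment f g - moment (f(j := u')) g\<bar> \<le> 2 / sqrt k"
proof (cases "f j = u'")
  case True
  then show ?thesis by (simp add: fun_upd_idem)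
next
  case ne: False
  define u where "u = f j"
  have fu: "f = f(j := u)" by (simp add: u_def)
  have gsub: "grid n k \<subseteq> {1..n}" using k by (rule grid_subset)
  have ug: "u \<in> grid n k" "u' \<in> grid n k" using incr_mem[OF f j] incr_mem[OF f' j] by (auto simp: u_def)
  have gi: "g i \<in> grid n k" if "i \<in> {1..d}" for i using incr_mem[OF g that] .
  have fi: "f i \<in> grid n k" if "i \<in> {1..d}" for i using incr_mem[OF f that] .
  define B where "B = {u..<u + k} \<union> {u'..<u' + k}"
  have rel: "(f i < x \<longleftrightarrow> i < j) \<and> (x < f i \<longleftrightarrow> j < i) \<and> x \<noteq> f i"
    if x: "x \<in> B" and i: "i \<in> {1..d}" "i \<noteq> j" for x i
  proof -
    obtain b where b: "b = u \<or> b = u'" "b \<le> x" "x < b + k"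
      using x unfolding B_def Un_iff atLeastLessThan_iff by metis
    have "(f i < b \<longleftrightarrow> i < j) \<and> (b < f i \<longleftrightarrow> j < i) \<and> b \<noteq> f i"
      using b(1)
    proof
      assume "b = u"
      then show ?thesis
        using incr_less_iff[OF f i(1) j] incr_less_iff[OF f j i(1)] incr_eq_iff[OF f j i(1)] i(2)
        by (simp add: u_def)
    next
      assume "b = u'"
      then show ?thesis
        using incr_less_iff[OF f' i(1) j] incr_less_iff[OF f' j i(1)] incr_eq_iff[OF f' j i(1)] i(2)
        by simp
    qed
    moreover have "k dvd f i" "k dvd b"
      using fi[OF i(1)] b(1) ug by (auto simp: grid_def)
    ultimately show ?thesis using dvd_block_less[of k "f i" b x] b(2,3) by metis
  qed
  have Bn: "B \<subseteq> {1..n}" using ug by (auto simp: B_def grid_def)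
  have inc: "incr d {1..n} (f(j := x))" if x: "x \<in> B" for x
    unfolding incr_def
  proof
    show "strict_mono_on {1..d} (f(j := x))"
      using rel[OF x] incr_less_iff[OF f] by (intro strict_mono_onI) auto
    show "(f(j := x)) ` {1..d} \<subseteq> {1..n}"
      using x Bn fi gsub by (auto split: if_splits)
  qed
  have g_inc: "incr d {1..n} g" using incr_mono[OF g gsub] .
  have uB: "u \<in> B" "u' \<in> B" using k by (auto simp: B_def)
  \<comment> \<open>the correlation with \<open>g\<close> does not change while \<open>x\<close> stays in one block\<close>
  have Kg: "moment (f(j := x)) g = moment (f(j := b)) g"
    if b: "b = u \<or> b = u'" "b \<le> x" "x < b + k" for x b
  proof (rule moment_order_type)
    have xB: "x \<in> B" "b \<in> B" using b uB by (auto simp: B_def)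
    show "incr d {1..n} (f(j := x))" "incr d {1..n} (f(j := b))" using xB by (auto intro: inc)
    show "incr d {1..n} g" "incr d {1..n} g" by fact+
    fix i l assume il: "i \<in> {1..d}" "l \<in> {1..d}"
    have "b \<noteq> g l" using ng b(1) imageI[OF il(2), of g] unfolding u_def by metis
    moreover have "k dvd g l" "k dvd b" using gi[OF il(2)] ug b(1) by (auto simp: grid_def)
    ultimately have "x < g l \<longleftrightarrow> b < g l" "x \<noteq> g l"
      using dvd_block_less[of k "g l" b x] b by auto
    then show "(f(j := x)) i < g l \<longleftrightarrow> (f(j := b)) i < g l"
      "(f(j := x)) i = g l \<longleftrightarrow> (f(j := b)) i = g l"
      using \<open>b \<noteq> g l\<close> by auto
  qed
  define \<rho> where "\<rho> = moment (f(j := min u u')) (f(j := max u u'))"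
  have \<rho>_less: "moment (f(j := x)) (f(j := y)) = \<rho>" if xy: "x \<in> B" "y \<in> B" "x < y" for x y
    unfolding \<rho>_def
  proof (rule moment_order_type)
    have m: "min u u' \<in> B" "max u u' \<in> B" "min u u' < max u u'"
      using uB ne by (auto simp: u_def min_def max_def)
    show "incr d {1..n} (f(j := x))" "incr d {1..n} (f(j := y))"
      "incr d {1..n} (f(j := min u u'))" "incr d {1..n} (f(j := max u u'))"
      using xy m by (auto intro: inc)
    fix i l assume il: "i \<in> {1..d}" "l \<in> {1..d}"
    show "(f(j := x)) i < (f(j := y)) l \<longleftrightarrow> (f(j := min u u')) i < (f(j := max u u')) l"
      using rel[OF xy(1) il(2)] rel[OF xy(2) il(1)] rel[OF m(1) il(2)] rel[OF m(2) il(1)] xy m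
      by (cases "i = j"; cases "l = j") auto
    show "(f(j := x)) i = (f(j := y)) l \<longleftrightarrow> (f(j := min u u')) i = (f(j := max u u')) l"
      using rel[OF xy(1) il(2)] rel[OF xy(2) il(1)] rel[OF m(1) il(2)] rel[OF m(2) il(1)] xy m
      by (cases "i = j"; cases "l = j") auto
  qed
  have \<rho>: "moment (f(j := x)) (f(j := y)) = \<rho>" if "x \<in> B" "y \<in> B" "x \<noteq> y" for x y
    using that \<rho>_less[of x y] \<rho>_less[of y x] moment_commute by (metis linorder_neqE_nat)
  have disj: "u + i \<noteq> u' + l" if "i < k" "l < k" for i l
  proof
    assume eq: "u + i = u' + l"
    have "k dvd u" "k dvd u'" "u \<noteq> u'" using ug ne by (auto simp: grid_def u_def)
    then have "u + i \<noteq> u'" "u' < u + i \<longleftrightarrow> u' < u" "u' + l \<noteq> u" "u < u' + l \<longleftrightarrow> u < u'"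
      using dvd_block_less[of k u' u "u + i"] dvd_block_less[of k u u' "u' + l"] that by auto
    then show False using eq by linarith
  qed
  define D where "D i = (\<lambda>\<omega>. X ((f(j := u + i)) ` {1..d}) \<omega> - X ((f(j := u' + i)) ` {1..d}) \<omega>)" for i
  have B1: "u + i \<in> B" "u' + i \<in> B" if "i < k" for i using that by (auto simp: B_def)
  have siX: "square_integrable M (X ((f(j := u + i)) ` {1..d}))"
      "square_integrable M (X ((f(j := u' + i)) ` {1..d}))" if "i < k" for i
    by (intro square_integrable_X_incr inc B1 that)+
  have siD: "square_integrable M (D i)" if "i < k" for i
    unfolding D_def using siX[OF that] by (rule square_integrable_diff)
  have ipD: "L2_inner M (D i) (D l)
      = moment (f(j := u + i)) (f(j := u + l)) - moment (f(j := u + i)) (f(j := u' + l))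
        - (moment (f(j := u' + i)) (f(j := u + l)) - moment (f(j := u' + i)) (f(j := u' + l)))"
    if "i < k" "l < k" for i l
  proof -
    have "L2_inner M (D i) (D l) = L2_inner M (X ((f(j := u + i)) ` {1..d})) (D l)
        - L2_inner M (X ((f(j := u' + i)) ` {1..d})) (D l)"
      unfolding D_def[of i] by (intro L2_inner_diff_left siX siD that)
    then show ?thesis
      unfolding D_def[of l] moment_def using that siX by (simp add: L2_inner_diff_right)
  qed
  have D_orth: "\<bar>L2_inner M (D i) (D l)\<bar> \<le> 0" if "i \<in> {..<k}" "l \<in> {..<k}" "i \<noteq> l" for i l
    using that by (simp add: ipD \<rho> B1 disj disj[symmetric])
  have D_norm: "L2_inner M (D i) (D i) \<le> 4" if "i < k" for i
    using abs_moment_le_1[OF inc[OF B1(1)[OF that]] inc[OF B1(2)[OF that]]] ipD[OF that that]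
      moment_self[OF inc[OF B1(1)[OF that]]] moment_self[OF inc[OF B1(2)[OF that]]]
      moment_commute[of "f(j := u' + i)" "f(j := u + i)"] by linarith
  let ?S = "\<lambda>\<omega>. \<Sum>i<k. D i \<omega>"
  have siS: "square_integrable M ?S" using siD by (intro square_integrable_sum) auto
  have "L2_inner M ?S ?S = (\<Sum>i<k. L2_inner M (D i) (D i))"
    using L2_inner_sum_almost_orthogonal[of "{..<k}" M D 0] siD D_orth by simp
  also have "\<dots> \<le> (\<Sum>i<k. 4)" using D_norm by (intro sum_mono) auto
  finally have SS: "L2_inner M ?S ?S \<le> 4 * k" by simp
  have siG: "square_integrable M (X (g ` {1..d}))" using g_inc by (rule square_integrable_X_incr)
  have "L2_inner M ?S (X (g ` {1..d})) = (\<Sum>i<k. L2_inner M (D i) (X (g ` {1..d})))"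
    using siD siG by (intro L2_inner_sum_left) auto
  also have "\<dots> = (\<Sum>i<k. moment f g - moment (f(j := u')) g)"
  proof (rule sum.cong)
    fix i assume "i \<in> {..<k}"
    then have i: "i < k" by simp
    have "L2_inner M (D i) (X (g ` {1..d})) = moment (f(j := u + i)) g - moment (f(j := u' + i)) g"
      unfolding D_def moment_def using siX[OF i] siG by (rule L2_inner_diff_left)
    also have "\<dots> = moment (f(j := u)) g - moment (f(j := u')) g"
      using Kg[of u "u + i"] Kg[of u' "u' + i"] i by simp
    finally show "L2_inner M (D i) (X (g ` {1..d})) = moment f g - moment (f(j := u')) g" using fu by simp
  qed simp
  finally have "k * \<bar>moment f g - moment (f(j := u')) g\<bar> = \<bar>L2_inner M ?S (X (g ` {1..d}))\<bar>"
    by (simp add: abs_mult)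
  \<comment> \<open>the weight balances the squared norms \<open>4 k\<close> of the sum and \<open>1\<close> of the fixed variable\<close>
  also have "\<dots> \<le> (1 / (2 * sqrt k) * L2_inner M ?S ?S + L2_inner M (X (g ` {1..d})) (X (g ` {1..d})) / (1 / (2 * sqrt k))) / 2"
    using k siS siG by (intro abs_L2_inner_le) auto
  also have "L2_inner M (X (g ` {1..d})) (X (g ` {1..d})) = 1" using moment_self[OF g_inc] by (simp add: moment_def)
  also have "1 / (2 * sqrt k) * L2_inner M ?S ?S \<le> 1 / (2 * sqrt k) * (4 * k)"
    using SS by (intro mult_left_mono) auto
  also have "1 / (2 * sqrt k) * (4 * k) = 2 * sqrt k"
    using k by (simp add: field_simps)
  finally have "k * \<bar>moment f g - moment (f(j := u')) g\<bar> \<le> 2 * sqrt k"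
    by (simp del: fun_upd_apply add: mult.commute)
  also have "\<dots> = k * (2 / sqrt k)" using k by (simp add: field_simps)
  finally show ?thesis using k by (simp only: mult_le_cancel_left_pos of_nat_0_less_iff)
qed

text \<open>Induction on the number of coordinates where the enumerations differ.  At the last such
coordinate, the smaller value can be raised to the larger one without violating monotonicity, because all later
coordinates agree; so one of the two enumerations moves one step towards the other.\<close>

lemma moment_move_card:
  assumes k: "k > 0" and g: "incr d (grid n k) g"
    and "incr d (grid n k) f" "incr d (grid n k) f'"
    and "\<And>i. i \<in> {1..d} \<Longrightarrow> f i \<noteq> f' i \<Longrightarrow> f i \<notin> g ` {1..d} \<and> f' i \<notin> g ` {1..d}"
    and "card {i\<in>{1..d}. f i \<noteq> f' i} = c"
  shows "\<bar>moment f g - moment f' g\<bar> \<le> c * (2 / sqrt k)"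
  using assms(3-)
proof (induction c arbitrary: f f')
  case 0
  then have "f ` {1..d} = f' ` {1..d}" by (intro image_cong) auto
  then show ?case by (simp add: moment_def)
next
  case (Suc c)
  let ?E = "{i\<in>{1..d}. f i \<noteq> f' i}"
  define m where "m = Max ?E"
  have "?E \<noteq> {}" using Suc.prems(4) by (metis card.empty nat.distinct(1))
  then have m: "m \<in> ?E" unfolding m_def by (intro Max_in) auto
  have above: "f i = f' i" if "i \<in> {1..d}" "m < i" for i
  proof (rule ccontr)
    assume "f i \<noteq> f' i"
    with that(1) have "i \<le> m" unfolding m_def by (intro Max_ge) auto
    with that(2) show False by simp
  qed
  have step: "incr d (grid n k) (h(m := h' m))"
    if h: "incr d (grid n k) h" "incr d (grid n k) h'" and less: "h m < h' m"
      and ab: "\<And>i. i \<in> {1..d} \<Longrightarrow> m < i \<Longrightarrow> h i = h' i" for h h'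
    unfolding incr_def
  proof
    show "strict_mono_on {1..d} (h(m := h' m))"
    proof (rule strict_mono_onI)
      fix a b assume ab': "a \<in> {1..d}" "b \<in> {1..d}" "a < b"
      then have "h a < h b" "h' a < h' b" by (simp_all add: incr_less_iff[OF h(1)] incr_less_iff[OF h(2)])
      then show "(h(m := h' m)) a < (h(m := h' m)) b" using ab' ab less by auto
    qed
    show "(h(m := h' m)) ` {1..d} \<subseteq> grid n k"
      using incr_mem[OF h(1)] incr_mem[OF h(2)] by auto
  qed
  have ce: "card (?E - {m}) = c" using Suc.prems(4) m by simp
  have ng: "f m \<notin> g ` {1..d}" "f' m \<notin> g ` {1..d}" and md: "m \<in> {1..d}" using Suc.prems(3) m by auto
  consider "f m < f' m" | "f' m < f m" using m by fastforce
  then show ?case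
  proof cases
    case 1
    let ?h = "f(m := f' m)"
    have h: "incr d (grid n k) ?h" using step[OF Suc.prems(1,2) 1 above] .
    have "\<bar>moment f g - moment ?h g\<bar> \<le> 2 / sqrt k"
      using moment_move_one[OF k Suc.prems(1) h g md ng] .
    moreover have "\<bar>moment ?h g - moment f' g\<bar> \<le> c * (2 / sqrt k)"
    proof (rule Suc.IH[OF h Suc.prems(2)])
      have "{i\<in>{1..d}. ?h i \<noteq> f' i} = ?E - {m}" by auto
      then show "card {i\<in>{1..d}. ?h i \<noteq> f' i} = c" using ce by simp
    qed (use Suc.prems(3) in \<open>auto split: if_splits\<close>)
    ultimately show ?thesis unfolding of_nat_Suc distrib_right mult_1_left by linarith
  next
    case 2
    let ?h = "f'(m := f m)"
    have h: "incr d (grid n k) ?h" using step[OF Suc.prems(2,1) 2] above by simp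
    have "\<bar>moment f' g - moment ?h g\<bar> \<le> 2 / sqrt k"
      using moment_move_one[OF k Suc.prems(2) h g md ng(2,1)] .
    moreover have "\<bar>moment f g - moment ?h g\<bar> \<le> c * (2 / sqrt k)"
    proof (rule Suc.IH[OF Suc.prems(1) h])
      have "{i\<in>{1..d}. f i \<noteq> ?h i} = ?E - {m}" by auto
      then show "card {i\<in>{1..d}. f i \<noteq> ?h i} = c" using ce by simp
    qed (use Suc.prems(3) in \<open>auto split: if_splits\<close>)
    ultimately show ?thesis unfolding of_nat_Suc distrib_right mult_1_left by linarith
  qed
qed

lemma moment_move:
  assumes k: "k > 0" and g: "incr d (grid n k) g"
    and "incr d (grid n k) f" "incr d (grid n k) f'"
    and "\<And>i. i \<in> {1..d} \<Longrightarrow> f i \<noteq> f' i \<Longrightarrow> f i \<notin> g ` {1..d} \<and> f' i \<notin> g ` {1..d}"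
  shows "\<bar>moment f g - moment f' g\<bar> \<le> 2 * real d / sqrt k"
proof -
  have "card {i\<in>{1..d}. f i \<noteq> f' i} \<le> card {1..d}" by (intro card_mono) auto
  then have "real (card {i\<in>{1..d}. f i \<noteq> f' i}) * (2 / sqrt k) \<le> d * (2 / sqrt k)"
    by (intro mult_right_mono) auto
  with moment_move_card[OF assms refl] show ?thesis by (simp add: mult.commute)
qed

end

section \<open>Partial maps and their total extensions\<close>

lemma part_incr_dom: "p \<in> part_incr F A \<Longrightarrow> dom p \<subseteq> F"
  by (simp add: part_incr_def)

lemma part_incr_val: "p \<in> part_incr F A \<Longrightarrow> i \<in> dom p \<Longrightarrow> the (p i) \<in> A"
  by (force simp: part_incr_def ran_def)

lemma part_incr_less:
  "p \<in> part_incr F A \<Longrightarrow> i \<in> dom p \<Longrightarrow> j \<in> dom p \<Longrightarrow> i < j \<Longrightarrow> the (p i) < the (p j)"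
  unfolding part_incr_def using strict_mono_onD[of "dom p" "the \<circ> p" i j] by simp

lemma part_incr_eq_iff:
  assumes "p \<in> part_incr F A" "i \<in> dom p" "j \<in> dom p"
  shows "the (p i) = the (p j) \<longleftrightarrow> i = j"
  using part_incr_less[OF assms] part_incr_less[OF assms(1,3,2)] by (cases i j rule: linorder_cases) auto

lemma part_incr_restrict:
  assumes "p \<in> part_incr F A"
  shows "p |` G \<in> part_incr F A"
proof -
  have "strict_mono_on (dom (p |` G)) (the \<circ> (p |` G))"
    using part_incr_less[OF assms] by (intro strict_mono_onI) (auto simp: dom_restrict)
  moreover have "ran (p |` G) \<subseteq> ran p" by (auto simp: ran_def restrict_map_def split: if_splits)
  ultimately show ?thesis using assms by (auto simp: part_incr_def)
qed

text \<open>The map \<open>as_map d f\<close> is the canonical isomorphism of the set enumerated by \<open>f\<close>, see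
\<open>canon_iso_image\<close>.\<close>

definition as_map :: "nat \<Rightarrow> (nat \<Rightarrow> nat) \<Rightarrow> nat \<rightharpoonup> nat" where
  "as_map d f = (\<lambda>i. if i \<in> {1..d} then Some (f i) else None)"

lemma dom_as_map [simp]: "dom (as_map d f) = {1..d}"
  by (auto simp: as_map_def split: if_splits)

lemma dom_as_map_restrict: "F \<subseteq> {1..d} \<Longrightarrow> dom (as_map d f |` F) = F"
  by auto

lemma as_map_part_incr: "incr d A f \<Longrightarrow> as_map d f \<in> part_incr {1..d} A"
  by (auto simp: part_incr_def incr_def as_map_def ran_def strict_mono_on_def split: if_splits)

lemma as_map_restrict_part_incr: "incr d A f \<Longrightarrow> as_map d f |` F \<in> part_incr {1..d} A"
  by (intro part_incr_restrict as_map_part_incr)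

lemma canon_iso_image:
  assumes "incr d A f"
  shows "canon_iso (f ` {1..d}) = as_map d f"
proof -
  have mono: "strict_mono_on {1..d} f" using assms by (simp add: incr_def)
  have "sorted_wrt (<) (map f [1..<Suc d])"
    unfolding sorted_wrt_map
    by (rule sorted_wrt_mono_rel[OF _ sorted_wrt_upt]) (use mono in \<open>auto simp: strict_mono_on_def\<close>)
  moreover have "set (map f [1..<Suc d]) = f ` {1..d}" by auto
  ultimately have "sorted_list_of_set (f ` {1..d}) = map f [1..<Suc d]"
    by (metis sorted_list_of_set.idem_if_sorted_distinct strict_sorted_iff)
  moreover have "card (f ` {1..d}) = d" using incr_inj[OF assms] by (simp add: card_image)
  ultimately show ?thesis
    by (auto simp: canon_iso_def as_map_def fun_eq_iff nth_map simp del: upt_Suc)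
qed

lemma nsets_incr:
  assumes "s \<in> nsets A d"
  obtains f where "incr d A f" "s = f ` {1..d}"
proof -
  define f where "f i = sorted_list_of_set s ! (i - 1)" for i
  have s: "finite s" "card s = d" "s \<subseteq> A" using assms by (auto simp: nsets_def)
  have im: "f ` {1..d} = s"
  proof -
    have "f ` {1..d} = (\<lambda>i. sorted_list_of_set s ! i) ` {..<d}"
    proof -
      have "j \<in> (\<lambda>i. i - 1) ` {1..d}" if "j < d" for j
        using that by (intro image_eqI[of _ _ "Suc j"]) auto
      then have "{..<d} = (\<lambda>i. i - 1) ` {1..d}" by auto
      then show ?thesis by (simp add: image_image f_def)
    qed
    also have "\<dots> = set (sorted_list_of_set s)"
      using s by (auto simp: set_conv_nth)
    finally show ?thesis using s by simp
  qed
  have "strict_mono_on {1..d} f"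
  proof (rule strict_mono_onI)
    fix i j assume "i \<in> {1..d}" "j \<in> {1..d}" "i < j"
    then show "f i < f j"
      unfolding f_def using s sorted_list_of_set.strict_sorted_key_list_of_set[of s]
      by (intro sorted_wrt_nth_less[of "(<)"]) auto
  qed
  with im s show ?thesis by (intro that[of f]) (auto simp: incr_def)
qed

text \<open>The set \<open>D\<close> collects the coordinates at which the two enumerations coincide; the common part of
the two restrictions is \<open>F \<inter> G \<inter> D\<close>.\<close>

lemma aligned_as_map:
  assumes agree: "\<And>i. i \<in> D \<Longrightarrow> f i = f' i"
    and only: "\<And>i j. i \<in> {1..d} \<Longrightarrow> j \<in> {1..d} \<Longrightarrow> f i = f' j \<Longrightarrow> i = j \<and> i \<in> D"
    and F: "F \<subseteq> {1..d}" "G \<subseteq> {1..d}"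
  shows "aligned (as_map d f |` F) (as_map d f' |` G)"
proof -
  let ?C = "F \<inter> G \<inter> D"
  have "?C \<subseteq> dom (as_map d f |` F) \<inter> dom (as_map d f' |` G)" using F by (auto simp: dom_as_map_restrict)
  moreover have "(as_map d f |` F) |` ?C = (as_map d f' |` G) |` ?C"
    using F agree by (auto simp: fun_eq_iff restrict_map_def as_map_def)
  moreover have "ran ((as_map d f |` F) |` (F - ?C)) \<inter> ran ((as_map d f' |` G) |` (G - ?C)) = {}"
  proof (rule ccontr)
    assume "\<not> ?thesis"
    then obtain x where "x \<in> ran ((as_map d f |` F) |` (F - ?C))" "x \<in> ran ((as_map d f' |` G) |` (G - ?C))"
      by blast
    then obtain i j where "i \<in> F - ?C" "j \<in> G - ?C" "x = f i" "x = f' j"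
      unfolding ran_def restrict_map_def as_map_def mem_Collect_eq by (metis option.distinct(1) option.inject)
    moreover from this F have "i \<in> {1..d}" "j \<in> {1..d}" by blast+
    ultimately show False using only[of i j] by auto
  qed
  ultimately show ?thesis
    unfolding aligned_def dom_as_map_restrict[OF F(1)] dom_as_map_restrict[OF F(2)]
    by (intro exI[of _ ?C] conjI)
qed

lemma part_incr_inj:
  assumes "p \<in> part_incr F A"
  shows "inj_on p (dom p)"
  using part_incr_eq_iff[OF assms] by (intro inj_onI) metis

text \<open>A value of \<open>p\<close> outside the common part \<open>G\<close> is attained by \<open>q\<close> neither on \<open>G\<close>, by injectivity
of \<open>p\<close>, nor off \<open>G\<close>, by disjointness.\<close>

lemma off_common_notin_ran:
  assumes inj: "inj_on p (dom p)" and G: "G \<subseteq> dom p" "p |` G = q |` G"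
    and disj: "ran (p |` (dom p - G)) \<inter> ran (q |` (dom q - G)) = {}"
    and j: "j \<in> dom p" "j \<notin> G"
  shows "the (p j) \<notin> ran q"
proof
  assume "the (p j) \<in> ran q"
  then obtain i where i: "q i = p j" using j by (auto simp: ran_def)
  have pj: "the (p j) \<in> ran (p |` (dom p - G))" using j by (auto simp: ran_def restrict_map_def)
  show False
  proof (cases "i \<in> G")
    case True
    then have "p i = p j" using i G(2) by (metis restrict_in)
    then have "i = j" using inj_onD[OF inj] True G(1) j(1) by blast
    then show False using True j(2) by simp
  next
    case False
    then have "the (p j) \<in> ran (q |` (dom q - G))"
      using i j by (auto simp: ran_def restrict_map_def)
    with pj disj show False by blast
  qed
qed

text \<open>Distinct maps cannot both have the common part as their domain, so one of them takes a value
that the other misses.  This is how alignment enters the proof of orthogonality.\<close>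

lemma aligned_witness:
  assumes p: "p \<in> part_incr F A" and q: "q \<in> part_incr F A" and "aligned p q" "p \<noteq> q"
  shows "(\<exists>j\<in>dom p. the (p j) \<notin> ran q) \<or> (\<exists>j\<in>dom q. the (q j) \<notin> ran p)"
proof -
  obtain G where G: "G \<subseteq> dom p \<inter> dom q" "p |` G = q |` G"
    "ran (p |` (dom p - G)) \<inter> ran (q |` (dom q - G)) = {}"
    using assms(3) unfolding aligned_def by blast
  have "dom p \<noteq> G \<or> dom q \<noteq> G"
  proof (rule ccontr)
    assume "\<not> ?thesis"
    then have "dom p = G" "dom q = G" by auto
    with G(2) have "p = q" by (metis (no_types, lifting) domIff ext restrict_in)
    with assms(4) show False ..
  qed
  then consider j where "j \<in> dom p" "j \<notin> G" | j where "j \<in> dom q" "j \<notin> G"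
    using G(1) by blast
  then show ?thesis
  proof cases
    case 1
    then show ?thesis using off_common_notin_ran[OF part_incr_inj[OF p] _ G(2,3)] G(1) by blast
  next
    case 2
    have "ran (q |` (dom q - G)) \<inter> ran (p |` (dom p - G)) = {}" using G(3) by blast
    then show ?thesis
      using 2 off_common_notin_ran[OF part_incr_inj[OF q] _ G(2)[symmetric]] G(1) by blast
  qed
qed

section \<open>Filling the gaps of a partial map\<close>

text \<open>The last position up to \<open>i\<close> in the domain of \<open>p\<close>, or \<open>0\<close> if there is none.\<close>

primrec anchor :: "(nat \<rightharpoonup> nat) \<Rightarrow> nat \<Rightarrow> nat" where
  "anchor p 0 = 0"
| "anchor p (Suc i) = (if Suc i \<in> dom p then Suc i else anchor p i)"

text \<open>Extends \<open>p\<close> to all positions.  A position outside the domain is placed above the value at its anchor,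
in steps of size \<open>c\<close>, using the \<open>r\<close>-th group of \<open>d\<close> steps; the value at the anchor \<open>0\<close> is taken
to be \<open>0\<close>.  If the values of \<open>p\<close> are multiples of \<open>c * Q\<close> with \<open>Q\<close> large, then the new values fit between them.\<close>

definition fill :: "nat \<Rightarrow> nat \<Rightarrow> (nat \<rightharpoonup> nat) \<Rightarrow> nat \<Rightarrow> nat \<Rightarrow> nat" where
  "fill d c p r i = (let a = anchor p i in
     (if a = 0 then 0 else the (p a)) + (if i = a then 0 else c * (r * d + (i - a))))"

lemma anchor_le: "anchor p i \<le> i"
  by (induction i) auto

lemma anchor_dom: "i \<in> dom p \<Longrightarrow> anchor p i = i"
  by (cases i) auto

lemma anchor_in_dom: "anchor p i \<noteq> 0 \<Longrightarrow> anchor p i \<in> dom p"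
  by (induction i) (auto split: if_splits)

lemma fill_0: "fill d c p r 0 = 0"
  by (simp add: fill_def)

lemma fill_dom: "1 \<le> i \<Longrightarrow> i \<in> dom p \<Longrightarrow> fill d c p r i = the (p i)"
  by (simp add: fill_def anchor_dom)

lemma fill_as_map: "i \<in> {1..d} \<Longrightarrow> fill d c (as_map d f) r i = f i"
  by (subst fill_dom) (auto simp: as_map_def)

text \<open>The bound \<open>t < d\<close> away from \<open>v = 0\<close> holds because an anchor in the domain is at least \<open>1\<close>; it
is responsible for the \<open>- 1\<close> in the range of \<open>fill_incr\<close>.\<close>

lemma fill_off:
  assumes p: "p \<in> part_incr {1..d} ((*) (c * Q) ` {1..l})" and i: "1 \<le> i" "i \<le> d" "i \<notin> dom p"
  obtains v t where "1 \<le> t" "t \<le> d" "fill d c p r i = c * (Q * v + (r * d + t))"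
    "v \<le> l" "v = 0 \<or> t < d"
proof -
  let ?a = "anchor p i"
  have a: "?a < i" using anchor_le[of p i] anchor_in_dom[of p i] i by (metis le_neq_implies_less not_one_le_zero)
  show ?thesis
  proof (cases "?a = 0")
    case True
    then show ?thesis using i by (intro that[of i 0]) (auto simp: fill_def Let_def)
  next
    case False
    then have "the (p ?a) \<in> (*) (c * Q) ` {1..l}" using part_incr_val[OF p] anchor_in_dom by blast
    then obtain v where v: "the (p ?a) = c * Q * v" "v \<le> l" by (metis atLeastAtMost_iff imageE)
    have "fill d c p r i = c * Q * v + c * (r * d + (i - ?a))"
      using False a v by (simp add: fill_def Let_def)
    then have "fill d c p r i = c * (Q * v + (r * d + (i - ?a)))" by (simp add: algebra_simps)
    moreover have "1 \<le> i - ?a" "i - ?a \<le> d" "i - ?a < d" using a i False by linarith+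
    ultimately show ?thesis using that[of "i - ?a" v] v(2) by blast
  qed
qed

lemma fill_less_Suc:
  assumes p: "p \<in> part_incr {1..d} ((*) (c * Q) ` {1..l})" and c: "c > 0"
    and r: "r < R" "R * d \<le> Q" and i: "i < d"
  shows "fill d c p r i < fill d c p r (Suc i)"
proof (cases "Suc i \<in> dom p")
  case False
  let ?a = "anchor p i"
  have "?a \<le> i" by (rule anchor_le)
  then have "(if i = ?a then 0 else c * (r * d + (i - ?a))) < c * (r * d + (Suc i - ?a))"
    using c by (auto simp: Suc_diff_le)
  moreover have "Suc i \<noteq> ?a" using \<open>?a \<le> i\<close> by simp
  ultimately show ?thesis using False by (simp add: fill_def Let_def)
next
  case True
  let ?a = "anchor p i"
  have a: "?a \<le> i" by (rule anchor_le)
  have "the (p (Suc i)) \<in> (*) (c * Q) ` {1..l}" using part_incr_val[OF p True] .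
  then obtain w where w: "the (p (Suc i)) = c * Q * w" "1 \<le> w" by (metis atLeastAtMost_iff imageE)
  obtain v where v: "(if ?a = 0 then 0 else the (p ?a)) = c * Q * v" "v < w"
  proof (cases "?a = 0")
    case True
    then show ?thesis using w by (intro that[of 0]) auto
  next
    case False
    then have dom: "?a \<in> dom p" by (rule anchor_in_dom)
    have "the (p ?a) \<in> (*) (c * Q) ` {1..l}" using part_incr_val[OF p dom] .
    then obtain v where v: "the (p ?a) = c * Q * v" by blast
    moreover have "the (p ?a) < the (p (Suc i))" using part_incr_less[OF p dom True] a by simp
    then have "v < w" using v w by simp
    ultimately show ?thesis using False by (intro that[of v]) auto
  qed
  have "Suc r * d \<le> R * d" using r by (intro mult_le_mono1) auto
  then have "r * d + (i - ?a) < Q" using r i a by simp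
  moreover have "0 < Q" using calculation by simp
  ultimately have "(if i = ?a then 0 else c * (r * d + (i - ?a))) < c * Q" using c by simp
  then have "fill d c p r i < c * Q * v + c * Q"
    using v(1) by (simp add: fill_def Let_def)
  also have "\<dots> = c * Q * Suc v" by simp
  also have "\<dots> \<le> c * Q * w" using v(2) by (intro mult_le_mono2) simp
  also have "\<dots> = fill d c p r (Suc i)" using fill_dom[OF _ True] w by simp
  finally show ?thesis .
qed

lemma fill_less:
  assumes "p \<in> part_incr {1..d} ((*) (c * Q) ` {1..l})" "c > 0" "r < R" "R * d \<le> Q"
    and "i < j" "j \<le> d"
  shows "fill d c p r i < fill d c p r j"
  using assms(5,6)
proof (induction j)
  case (Suc j)
  then show ?case
    using fill_less_Suc[OF assms(1-4), of j] by (cases "i = j") auto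
qed simp

lemma fill_incr:
  assumes p: "p \<in> part_incr {1..d} ((*) (c * Q) ` {1..l})" and c: "c > 0"
    and r: "r < R" "R * d \<le> Q" and l: "1 \<le> l" and d: "1 \<le> d"
  shows "incr d ((*) c ` {1..l * Q + R * d - 1}) (fill d c p r)"
  unfolding incr_def
proof
  show "strict_mono_on {1..d} (fill d c p r)"
    by (rule strict_mono_onI) (use fill_less[OF p c r] in auto)
  have Rd: "r * d + d \<le> R * d"
    using r mult_le_mono1[of "Suc r" R d] by simp
  have Q: "1 \<le> Q" using Rd r d by linarith
  have lQ: "1 \<le> l * Q" using l Q by (metis mult_le_mono mult_1)
  show "fill d c p r ` {1..d} \<subseteq> (*) c ` {1..l * Q + R * d - 1}"
  proof
    fix x assume "x \<in> fill d c p r ` {1..d}"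
    then obtain i where i: "x = fill d c p r i" "1 \<le> i" "i \<le> d" by auto
    have "0 < x" using fill_less[OF p c r, of 0 i] i by (simp add: fill_0)
    have "\<exists>y. x = c * y \<and> y \<le> l * Q + R * d - 1"
    proof (cases "i \<in> dom p")
      case True
      then have "x \<in> (*) (c * Q) ` {1..l}" using part_incr_val[OF p True] i by (simp add: fill_dom)
      then obtain v where v: "x = c * Q * v" "v \<le> l" by (metis atLeastAtMost_iff imageE)
      then have "Q * v \<le> l * Q" by (simp add: mult.commute)
      then have "Q * v \<le> l * Q + R * d - 1" using Rd d by linarith
      with v show ?thesis by (metis mult.assoc)
    next
      case False
      from fill_off[OF p i(2,3) False, of r] obtain v t
        where vt: "1 \<le> t" "t \<le> d" "fill d c p r i = c * (Q * v + (r * d + t))"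
          "v \<le> l" "v = 0 \<or> t < d" .
      have "Q * v + (r * d + t) \<le> l * Q + R * d - 1"
      proof (cases "v = 0")
        case True
        then show ?thesis using vt Rd lQ by simp
      next
        case False
        moreover have "Q * v \<le> l * Q" using vt(4) by (simp add: mult.commute)
        ultimately show ?thesis using vt Rd by linarith
      qed
      then show ?thesis using vt i by auto
    qed
    then obtain y where y: "x = c * y" "y \<le> l * Q + R * d - 1" by blast
    then have "1 \<le> y" using \<open>0 < x\<close> by (cases y) auto
    with y show "x \<in> (*) c ` {1..l * Q + R * d - 1}" by auto
  qed
qed

text \<open>The residue modulo \<open>Q\<close> of a new value, measured in steps, lies in the \<open>r\<close>-th group of \<open>d\<close>
residues.  So it reveals \<open>r\<close>, and new values for different \<open>r\<close> are different, whatever maps they extend.\<close>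

lemma filler_mod:
  assumes p: "p \<in> part_incr {1..d} ((*) (c * Q) ` {1..l})" and c: "c > 0"
    and r: "r < R" "R * d < Q" and i: "1 \<le> i" "i \<le> d" "i \<notin> dom p"
  shows "c dvd fill d c p r i" "(fill d c p r i div c) mod Q \<noteq> 0"
    "((fill d c p r i div c) mod Q - 1) div d = r"
proof -
  from fill_off[OF p i, of r] obtain v t
    where vt: "1 \<le> t" "t \<le> d" "fill d c p r i = c * (Q * v + (r * d + t))" .
  have "r * d + d \<le> R * d" using r mult_le_mono1[of "Suc r" R d] by simp
  then have lt: "r * d + t < Q" using r vt by linarith
  have m: "(fill d c p r i div c) mod Q = r * d + t" using vt c lt by simp
  show "c dvd fill d c p r i" using vt by simp
  show "(fill d c p r i div c) mod Q \<noteq> 0" using m vt by simp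
  have "r * d + t - 1 = (t - 1) + r * d" using vt by simp
  moreover have "((t - 1) + r * d) div d = r" using vt by (subst div_mult_self1) auto
  ultimately show "((fill d c p r i div c) mod Q - 1) div d = r" using m by simp
qed

lemma filler_not_multiple:
  assumes "p \<in> part_incr {1..d} ((*) (c * Q) ` {1..l})" "c > 0"
    and "r < R" "R * d < Q" and "1 \<le> i" "i \<le> d" "i \<notin> dom p"
  shows "fill d c p r i \<noteq> c * Q * v"
proof
  assume "fill d c p r i = c * Q * v"
  then have "fill d c p r i = c * (Q * v)" by (simp add: mult.assoc)
  then have "(fill d c p r i div c) mod Q = 0" using assms(2) by simp
  with filler_mod(2)[OF assms] show False by simp
qed

lemma filler_disjoint:
  assumes p: "p \<in> part_incr {1..d} ((*) (c * Q) ` {1..l})" and q: "q \<in> part_incr {1..d} ((*) (c * Q) ` {1..l})"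
    and c: "c > 0" and r: "r < R" "r' < R" "R * d < Q" and ne: "r \<noteq> r'"
    and i: "1 \<le> i" "i \<le> d" "i \<notin> dom p" and j: "1 \<le> j" "j \<le> d"
  shows "fill d c p r i \<noteq> fill d c q r' j"
proof (cases "j \<in> dom q")
  case True
  then have "the (q j) \<in> (*) (c * Q) ` {1..l}" using part_incr_val[OF q] by blast
  then obtain v where "fill d c q r' j = c * Q * v" using True j by (auto simp: fill_dom)
  with filler_not_multiple[OF p c r(1,3) i] show ?thesis by simp
next
  case False
  have "((fill d c p r i div c) mod Q - 1) div d = r" using filler_mod(3)[OF p c r(1,3) i] .
  moreover have "((fill d c q r' j div c) mod Q - 1) div d = r'" using filler_mod(3)[OF q c r(2,3) j False] .
  ultimately show ?thesis using ne by auto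
qed

lemma as_map_fill_restrict:
  assumes "p \<in> part_incr {1..d} A"
  shows "as_map d (fill d c p r) |` dom p = p"
proof
  fix i
  have d: "dom p \<subseteq> {1..d}" using assms by (rule part_incr_dom)
  show "(as_map d (fill d c p r) |` dom p) i = p i"
  proof (cases "i \<in> dom p")
    case True
    then show ?thesis using d by (auto simp: as_map_def fill_dom)
  next
    case False
    then show ?thesis by (simp add: restrict_map_def domIff)
  qed
qed

section \<open>Construction of the decomposition\<close>

text \<open>The set \<open>N\<close> will consist of \<open>m\<close> multiples of \<open>k * Q\<close>.  Between two of them there is room for \<open>k\<close>
groups of \<open>d\<close> points of the grid of multiples of \<open>k\<close>, one group for each extension that enters an average, and above
the last one there is room for the same and one more block of length \<open>k\<close>.\<close>

locale sparse_array = unit_spreadable_array M d n X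
  for M :: "'a measure" and d n :: nat and X :: "nat set \<Rightarrow> 'a \<Rightarrow> real" +
  fixes k Q m :: nat
  assumes k_pos: "k > 0" and Q: "k * d < Q" and m_pos: "1 \<le> m" and room: "k * Q * (m + 1) \<le> n"
begin

definition N :: "nat set" where "N = (*) (k * Q) ` {1..m}"

text \<open>A finite substitute for the conditional expectation of the array given the indices in the image of
\<open>p\<close>: the remaining indices are averaged over \<open>k\<close> disjoint choices.\<close>

definition avg :: "(nat \<rightharpoonup> nat) \<Rightarrow> 'a \<Rightarrow> real" where
  "avg p \<omega> = (1 / real k) * (\<Sum>r<k. X (fill d k p r ` {1..d}) \<omega>)"

definition component :: "(nat \<rightharpoonup> nat) \<Rightarrow> 'a \<Rightarrow> real" where
  "component p \<omega> = alt_sum (\<lambda>G. avg (p |` G) \<omega>) (dom p)"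

lemma fill_grid:
  assumes "p \<in> part_incr {1..d} N" "r < k"
  shows "incr d (grid n k) (fill d k p r)"
proof (rule incr_mono)
  show "incr d ((*) k ` {1..m * Q + k * d - 1}) (fill d k p r)"
    using assms k_pos Q m_pos d_pos unfolding N_def by (intro fill_incr) auto
  show "(*) k ` {1..m * Q + k * d - 1} \<subseteq> grid n k"
  proof
    fix x assume "x \<in> (*) k ` {1..m * Q + k * d - 1}"
    then obtain y where "x = k * y" "y \<in> {1..m * Q + k * d - 1}" by (rule imageE)
    then have y: "x = k * y" "1 \<le> y" "y \<le> m * Q + k * d - 1" by simp_all
    have "Suc y \<le> m * Q + Q" using y Q by linarith
    then have "k * Suc y \<le> k * (m * Q + Q)" by (rule mult_le_mono2)
    also have "\<dots> = k * Q * (m + 1)" by (simp add: algebra_simps)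
    also have "\<dots> \<le> n" by (rule room)
    finally have "k * y + k \<le> n" by simp
    moreover have "1 \<le> k * y" using y(2) k_pos by (simp add: Suc_le_eq One_nat_def)
    ultimately show "x \<in> grid n k" using y(1) by (simp add: grid_def)
  qed
qed

lemma fill_range: "p \<in> part_incr {1..d} N \<Longrightarrow> r < k \<Longrightarrow> incr d {1..n} (fill d k p r)"
  using incr_mono[OF fill_grid grid_subset[OF k_pos]] .

lemma square_integrable_X_fill:
  "p \<in> part_incr {1..d} N \<Longrightarrow> r < k \<Longrightarrow> square_integrable M (X (fill d k p r ` {1..d}))"
  by (intro square_integrable_X_incr fill_range)

lemma square_integrable_avg: "p \<in> part_incr {1..d} N \<Longrightarrow> square_integrable M (avg p)"
  unfolding avg_def by (intro square_integrable_cmult square_integrable_sum square_integrable_X_fill) auto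

lemma L2_inner_avg:
  assumes "p \<in> part_incr {1..d} N" "q \<in> part_incr {1..d} N"
  shows "L2_inner M (avg p) (avg q) = (1 / (real k)\<^sup>2) * (\<Sum>r<k. \<Sum>r'<k. moment (fill d k p r) (fill d k q r'))"
proof -
  have si: "square_integrable M (X (fill d k p r ` {1..d}))"
    "square_integrable M (X (fill d k q r ` {1..d}))" if "r \<in> {..<k}" for r
    using that assms by (auto intro: square_integrable_X_fill)
  have "L2_inner M (avg p) (avg q) = (1 / real k) * ((1 / real k) *
      L2_inner M (\<lambda>\<omega>. \<Sum>r<k. X (fill d k p r ` {1..d}) \<omega>) (\<lambda>\<omega>. \<Sum>r<k. X (fill d k q r ` {1..d}) \<omega>))"
    unfolding avg_def L2_inner_cmult_left L2_inner_cmult_right by simp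
  also have "L2_inner M (\<lambda>\<omega>. \<Sum>r<k. X (fill d k p r ` {1..d}) \<omega>) (\<lambda>\<omega>. \<Sum>r<k. X (fill d k q r ` {1..d}) \<omega>)
      = (\<Sum>r<k. L2_inner M (X (fill d k p r ` {1..d})) (\<lambda>\<omega>. \<Sum>r<k. X (fill d k q r ` {1..d}) \<omega>))"
    by (intro L2_inner_sum_left square_integrable_sum si)
  also have "\<dots> = (\<Sum>r<k. \<Sum>r'<k. moment (fill d k p r) (fill d k q r'))"
    unfolding moment_def by (intro sum.cong refl L2_inner_sum_right si)
  finally show ?thesis by (simp add: power2_eq_square)
qed

text \<open>For \<open>r \<noteq> r'\<close> the new indices on the two sides are disjoint, and the value of \<open>p\<close> at \<open>j\<close> is missed
by \<open>q\<close>.  Hence forgetting the value at \<open>j\<close> moves only indices that are foreign to the other set, before and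
after the move.\<close>

lemma moment_fill_diff:
  assumes p: "p \<in> part_incr {1..d} N" and q: "q \<in> part_incr {1..d} N"
    and j: "j \<in> dom p" "the (p j) \<notin> ran q" and r: "r < k" "r' < k" "r \<noteq> r'"
  shows "\<bar>moment (fill d k p r) (fill d k q r') - moment (fill d k (p |` (dom p - {j})) r) (fill d k q r')\<bar>
    \<le> 2 * real d / sqrt k"
proof (rule moment_move)
  let ?p = "p |` (dom p - {j})"
  have p': "?p \<in> part_incr {1..d} N" using p by (rule part_incr_restrict)
  show "k > 0" by (rule k_pos)
  show "incr d (grid n k) (fill d k q r')" "incr d (grid n k) (fill d k p r)"
    "incr d (grid n k) (fill d k ?p r)" using p p' q r by (auto intro: fill_grid)
  fix i assume i: "i \<in> {1..d}" and ne: "fill d k p r i \<noteq> fill d k ?p r i"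
  have i12: "1 \<le> i" "i \<le> d" using i by auto
  have disj: "fill d k p0 r i \<noteq> fill d k q r' l"
    if "p0 \<in> part_incr {1..d} N" "i \<notin> dom p0" "l \<in> {1..d}" for p0 l
    using filler_disjoint[OF that(1)[unfolded N_def] q[unfolded N_def] k_pos r(1,2) Q r(3) i12 that(2)] that(3)
    by simp
  have i': "i \<notin> dom ?p"
  proof
    assume "i \<in> dom ?p"
    then have "i \<in> dom p" "?p i = p i" by auto
    then show False using ne fill_dom[OF i12(1)] \<open>i \<in> dom ?p\<close> by metis
  qed
  have "fill d k p r i \<noteq> fill d k q r' l" if l: "l \<in> {1..d}" for l
  proof (cases "i \<in> dom p")
    case False
    then show ?thesis using disj[OF p _ l] by blast
  next
    case True
    with i' have ij: "i = j" by auto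
    then have pi: "fill d k p r i = the (p j)" using True i12 by (simp add: fill_dom)
    show ?thesis
    proof (cases "l \<in> dom q")
      case True
      then have "the (q l) \<in> ran q" by (auto simp: ran_def)
      then show ?thesis using pi j(2) fill_dom[of l q] True l by auto
    next
      case False
      have "the (p j) \<in> N" using part_incr_val[OF p j(1)] .
      then obtain v where v: "the (p j) = k * Q * v" unfolding N_def by blast
      show ?thesis
        using filler_not_multiple[OF q[unfolded N_def] k_pos r(2) Q _ _ False, of v] l pi v by auto
    qed
  qed
  then show "fill d k p r i \<notin> fill d k q r' ` {1..d} \<and> fill d k ?p r i \<notin> fill d k q r' ` {1..d}"
    using disj[OF p' i'] by blast
qed

text \<open>The moments with \<open>r = r'\<close> are not controlled, but they are only \<open>k\<close> of the
\<open>k\<^sup>2\<close> moments and contribute at most \<open>2 / k\<close>.\<close>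

lemma L2_inner_avg_diff:
  assumes p: "p \<in> part_incr {1..d} N" and q: "q \<in> part_incr {1..d} N"
    and j: "j \<in> dom p" "the (p j) \<notin> ran q"
  shows "\<bar>L2_inner M (\<lambda>\<omega>. avg p \<omega> - avg (p |` (dom p - {j})) \<omega>) (avg q)\<bar> \<le> 4 * real d / sqrt k"
proof -
  let ?p = "p |` (dom p - {j})"
  let ?D = "\<lambda>r r'. moment (fill d k p r) (fill d k q r') - moment (fill d k ?p r) (fill d k q r')"
  have p': "?p \<in> part_incr {1..d} N" using p by (rule part_incr_restrict)
  have "real k * 1 \<le> real k * real k" using k_pos by (intro mult_left_mono) auto
  then have "sqrt k \<le> k" by (intro real_le_lsqrt) (simp_all add: power2_eq_square)
  moreover have "sqrt k > 0" "real d \<ge> 1" using k_pos d_pos by auto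
  ultimately have s: "sqrt k > 0" "sqrt k \<le> k" "real d \<ge> 1" by blast+
  define c where "c = 2 * real d / sqrt k"
  have c: "0 \<le> c" by (simp add: c_def)
  have bound: "\<bar>?D r r'\<bar> \<le> (if r = r' then 2 else 0) + c" if r: "r \<in> {..<k}" "r' \<in> {..<k}" for r r'
  proof (cases "r = r'")
    case True
    have "\<bar>moment (fill d k p r) (fill d k q r')\<bar> \<le> 1" "\<bar>moment (fill d k ?p r) (fill d k q r')\<bar> \<le> 1"
      using r p p' q by (auto intro!: abs_moment_le_1 fill_range)
    then show ?thesis unfolding if_P[OF True] using c by linarith
  next
    case False
    then show ?thesis using moment_fill_diff[OF p q j, of r r'] r by (simp add: c_def)
  qed
  have "L2_inner M (\<lambda>\<omega>. avg p \<omega> - avg ?p \<omega>) (avg q) = L2_inner M (avg p) (avg q) - L2_inner M (avg ?p) (avg q)"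
    using p p' q by (intro L2_inner_diff_left square_integrable_avg)
  also have "\<dots> = (1 / (real k)\<^sup>2) * (\<Sum>r<k. \<Sum>r'<k. ?D r r')"
    unfolding L2_inner_avg[OF p q] L2_inner_avg[OF p' q] sum_subtractf right_diff_distrib by (rule refl)
  finally have "\<bar>L2_inner M (\<lambda>\<omega>. avg p \<omega> - avg ?p \<omega>) (avg q)\<bar> = (1 / (real k)\<^sup>2) * \<bar>\<Sum>r<k. \<Sum>r'<k. ?D r r'\<bar>"
    by (simp add: abs_mult)
  also have "\<dots> \<le> (1 / (real k)\<^sup>2) * (2 * k + (real k)\<^sup>2 * c)"
  proof (rule mult_left_mono)
    have "\<bar>\<Sum>r<k. \<Sum>r'<k. ?D r r'\<bar> \<le> (\<Sum>r<k. \<Sum>r'<k. \<bar>?D r r'\<bar>)"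
      by (intro order.trans[OF sum_abs] sum_mono sum_abs)
    also have "\<dots> \<le> (\<Sum>r<k. \<Sum>r'<k. (if r = r' then 2 else 0) + c)"
      by (intro sum_mono bound)
    also have "\<dots> = 2 * k + (real k)\<^sup>2 * c"
      by (simp add: sum.distrib power2_eq_square algebra_simps)
    finally show "\<bar>\<Sum>r<k. \<Sum>r'<k. ?D r r'\<bar> \<le> 2 * k + (real k)\<^sup>2 * c" .
  qed simp
  also have "\<dots> = 2 / k + c"
    using k_pos by (simp add: field_simps power2_eq_square)
  also have "2 / real k \<le> c"
    unfolding c_def using s k_pos by (intro frac_le) auto
  also have "c + c = 4 * real d / sqrt k" by (simp add: c_def)
  finally show ?thesis by simp
qed

lemma square_integrable_component: "p \<in> part_incr {1..d} N \<Longrightarrow> square_integrable M (component p)"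
  unfolding component_def alt_sum_def
  by (intro square_integrable_sum square_integrable_cmult square_integrable_avg part_incr_restrict)

lemma finite_dom: "p \<in> part_incr {1..d} N \<Longrightarrow> finite (dom p)"
  by (rule finite_subset[OF part_incr_dom]) auto

lemma component_split:
  assumes p: "p \<in> part_incr {1..d} N" and j: "j \<in> dom p"
  shows "component p \<omega> = (\<Sum>A\<in>Pow (dom p - {j}). (-1) ^ card (dom p - {j} - A)
      * (avg (p |` insert j A) \<omega> - avg (p |` A) \<omega>))"
proof -
  have "dom p = insert j (dom p - {j})" using j by auto
  then have "component p \<omega> = alt_sum (\<lambda>G. avg (p |` G) \<omega>) (insert j (dom p - {j}))"
    by (simp add: component_def)
  also have "\<dots> = alt_sum (\<lambda>G. avg (p |` insert j G) \<omega> - avg (p |` G) \<omega>) (dom p - {j})"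
    using finite_dom[OF p] by (intro alt_sum_insert) auto
  finally show ?thesis by (simp add: alt_sum_def)
qed

lemma card_Pow_dom:
  assumes "p \<in> part_incr {1..d} N" "S \<subseteq> dom p"
  shows "real (card (Pow S)) \<le> 2 ^ d"
proof -
  have "S \<subseteq> {1..d}" using assms(2) part_incr_dom[OF assms(1)] by blast
  then have "card S \<le> d" "finite S" using card_mono[of "{1..d}" S] finite_subset[of S "{1..d}"] by auto
  then show ?thesis by (simp add: card_Pow)
qed

lemma component_orthogonal_aux:
  assumes p: "p \<in> part_incr {1..d} N" and q: "q \<in> part_incr {1..d} N"
    and j: "j \<in> dom p" "the (p j) \<notin> ran q"
  shows "\<bar>L2_inner M (component p) (component q)\<bar> \<le> 4 ^ d * (4 * real d / sqrt k)"
proof -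
  let ?P = "Pow (dom p - {j})" and ?Q = "Pow (dom q)"
  let ?s = "\<lambda>A. (-1) ^ card (dom p - {j} - A) :: real" and ?t = "\<lambda>B. (-1) ^ card (dom q - B) :: real"
  let ?U = "\<lambda>A \<omega>. avg (p |` insert j A) \<omega> - avg (p |` A) \<omega>"
  have siU: "square_integrable M (?U A)" for A
    using p by (intro square_integrable_diff square_integrable_avg part_incr_restrict)
  have siY: "square_integrable M (avg (q |` B))" for B
    using q by (intro square_integrable_avg part_incr_restrict)
  have bd: "\<bar>L2_inner M (?U A) (avg (q |` B))\<bar> \<le> 4 * real d / sqrt k" if A: "A \<in> ?P" and B: "B \<in> ?Q" for A B
  proof -
    let ?p = "p |` insert j A"
    have "dom ?p = insert j A" using A j(1) by auto
    moreover have "?p |` (insert j A - {j}) = p |` A" using A by (auto simp: fun_eq_iff restrict_map_def)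
    moreover have "ran (q |` B) \<subseteq> ran q" by (auto simp: ran_def restrict_map_def split: if_splits)
    moreover have "?p j = p j" by simp
    ultimately show ?thesis
      using L2_inner_avg_diff[of ?p "q |` B" j] part_incr_restrict[OF p] part_incr_restrict[OF q] j(2) by auto
  qed
  have "component p = (\<lambda>\<omega>. \<Sum>A\<in>?P. ?s A * ?U A \<omega>)" using component_split[OF p j(1)] by auto
  moreover have "component q = (\<lambda>\<omega>. \<Sum>B\<in>?Q. ?t B * avg (q |` B) \<omega>)" by (auto simp: component_def alt_sum_def)
  ultimately have "L2_inner M (component p) (component q)
      = L2_inner M (\<lambda>\<omega>. \<Sum>A\<in>?P. ?s A * ?U A \<omega>) (\<lambda>\<omega>. \<Sum>B\<in>?Q. ?t B * avg (q |` B) \<omega>)" by simp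
  also have "\<bar>\<dots>\<bar> \<le> real (card ?P) * real (card ?Q) * (4 * real d / sqrt k)"
    by (rule abs_L2_inner_combination_le[OF siU siY _ _ bd]) (simp_all add: power_abs)
  also have "\<dots> \<le> 2 ^ d * 2 ^ d * (4 * real d / sqrt k)"
    using card_Pow_dom[OF p, of "dom p - {j}"] card_Pow_dom[OF q, of "dom q"]
    by (intro mult_right_mono mult_mono) auto
  also have "(2::real) ^ d * 2 ^ d = 4 ^ d" by (simp flip: power_mult_distrib)
  finally show ?thesis .
qed

lemma component_orthogonal:
  assumes p: "p \<in> part_incr {1..d} N" and q: "q \<in> part_incr {1..d} N"
    and "aligned p q" "p \<noteq> q"
  shows "\<bar>L2_inner M (component p) (component q)\<bar> \<le> 4 ^ d * (4 * real d / sqrt k)"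
proof -
  consider j where "j \<in> dom p" "the (p j) \<notin> ran q" | j where "j \<in> dom q" "the (q j) \<notin> ran p"
    using aligned_witness[OF assms] by blast
  then show ?thesis
  proof cases
    case 1
    then show ?thesis using component_orthogonal_aux[OF p q] by blast
  next
    case 2
    then show ?thesis using component_orthogonal_aux[OF q p] by (subst L2_inner_commute) blast
  qed
qed

lemma integrable_avg: "p \<in> part_incr {1..d} N \<Longrightarrow> integrable M (avg p)"
  by (intro square_integrable_integrable square_integrable_avg)

lemma mean_avg:
  assumes "p \<in> part_incr {1..d} N" "q \<in> part_incr {1..d} N"
  shows "(\<integral>\<omega>. avg p \<omega> \<partial>M) = (\<integral>\<omega>. avg q \<omega> \<partial>M)"
proof -
  have int: "integrable M (X (fill d k p r ` {1..d}))" if "p \<in> part_incr {1..d} N" "r \<in> {..<k}" for p r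
    using that by (intro square_integrable_integrable square_integrable_X_fill) auto
  have "(\<Sum>r<k. \<integral>\<omega>. X (fill d k p r ` {1..d}) \<omega> \<partial>M) = (\<Sum>r<k. \<integral>\<omega>. X (fill d k q r ` {1..d}) \<omega> \<partial>M)"
    using assms by (intro sum.cong refl mean_eq fill_range) auto
  then show ?thesis
    using assms int unfolding avg_def by (simp add: Bochner_Integration.integral_sum)
qed

text \<open>All averages have the same mean, so each difference in the split alternating sum has mean zero.\<close>

lemma mean_component:
  assumes p: "p \<in> part_incr {1..d} N" and ne: "p \<noteq> Map.empty"
  shows "(\<integral>\<omega>. component p \<omega> \<partial>M) = 0"
proof -
  obtain j where j: "j \<in> dom p" using ne by fastforce
  let ?P = "Pow (dom p - {j})" and ?s = "\<lambda>A. (-1) ^ card (dom p - {j} - A) :: real"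
  have int: "integrable M (avg (p |` A))" for A using p by (intro integrable_avg part_incr_restrict)
  have "(\<integral>\<omega>. component p \<omega> \<partial>M) = (\<integral>\<omega>. (\<Sum>A\<in>?P. ?s A * (avg (p |` insert j A) \<omega> - avg (p |` A) \<omega>)) \<partial>M)"
    using component_split[OF p j] by simp
  also have "\<dots> = (\<Sum>A\<in>?P. \<integral>\<omega>. ?s A * (avg (p |` insert j A) \<omega> - avg (p |` A) \<omega>) \<partial>M)"
    by (intro Bochner_Integration.integral_sum integrable_mult_right Bochner_Integration.integrable_diff int)
  also have "\<dots> = (\<Sum>A\<in>?P. 0)"
  proof (intro sum.cong refl)
    fix A
    have "(\<integral>\<omega>. ?s A * (avg (p |` insert j A) \<omega> - avg (p |` A) \<omega>) \<partial>M)
        = ?s A * ((\<integral>\<omega>. avg (p |` insert j A) \<omega> \<partial>M) - (\<integral>\<omega>. avg (p |` A) \<omega> \<partial>M))"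
      using int by simp
    also have "\<dots> = 0" using mean_avg[of "p |` insert j A" "p |` A"] part_incr_restrict[OF p] by simp
    finally show "(\<integral>\<omega>. ?s A * (avg (p |` insert j A) \<omega> - avg (p |` A) \<omega>) \<partial>M) = 0" .
  qed
  finally show ?thesis by simp
qed

text \<open>By Moebius inversion the components at the restrictions of a total map sum up to the average at the total
map; there is nothing left to fill, so this average is the variable itself.\<close>

lemma decomposition_component: "decomposition M d N X component"
  unfolding decomposition_def
proof (intro ballI AE_I2)
  fix s \<omega> assume "s \<in> nsets N d"
  then obtain f where f: "incr d N f" "s = f ` {1..d}" by (rule nsets_incr)
  have "component (as_map d f |` F) \<omega> = alt_sum (\<lambda>G. avg (as_map d f |` G) \<omega>) F" if "F \<in> Pow {1..d}" for F
  proof -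
    have "dom (as_map d f |` F) = F" using that by auto
    moreover have "(as_map d f |` F) |` G = as_map d f |` G" if "G \<subseteq> F" for G
      using that by (simp add: inf_absorb2)
    ultimately show ?thesis unfolding component_def by (metis (no_types, lifting) alt_sum_cong)
  qed
  then have "(\<Sum>F\<in>Pow {1..d}. component (as_map d f |` F) \<omega>)
      = (\<Sum>F\<in>Pow {1..d}. alt_sum (\<lambda>G. avg (as_map d f |` G) \<omega>) F)"
    by (rule sum.cong[OF refl])
  also have "\<dots> = avg (as_map d f |` {1..d}) \<omega>" by (rule sum_alt_sum) simp
  also have "as_map d f |` {1..d} = as_map d f" by (auto simp: fun_eq_iff restrict_map_def as_map_def)
  also have "avg (as_map d f) \<omega> = X s \<omega>"
  proof -
    have "fill d k (as_map d f) r ` {1..d} = s" for r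
      using f(2) by (auto simp: fill_as_map intro!: image_cong)
    then show ?thesis using k_pos by (simp add: avg_def)
  qed
  finally show "X s \<omega> = (\<Sum>F\<in>Pow {1..d}. component (canon_iso s |` F) \<omega>)"
    using canon_iso_image[OF f(1)] f(2) by simp
qed

lemma real_process_component: "real_process M (part_incr {1..d} N) component"
  unfolding real_process_def using square_integrable_component square_integrable_measurable by blast

lemma approx_zero_mean_component:
  assumes "0 \<le> \<epsilon>"
  shows "approx_zero_mean M d N \<epsilon> component"
  unfolding approx_zero_mean_def
proof (intro ballI impI conjI)
  fix p assume p: "p \<in> part_incr {1..d} N" "p \<noteq> Map.empty"
  show "integrable M (component p)"
    by (intro square_integrable_integrable square_integrable_component p)
  show "\<bar>\<integral>\<omega>. component p \<omega> \<partial>M\<bar> \<le> \<epsilon>" using mean_component[OF p] assms by simp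
qed

lemma approx_orthogonal_component:
  assumes "4 ^ d * (4 * real d / sqrt k) \<le> \<epsilon>"
  shows "approx_orthogonal M d N \<epsilon> component"
  unfolding approx_orthogonal_def
proof (intro ballI impI conjI)
  fix p q assume pq: "p \<in> part_incr {1..d} N" "q \<in> part_incr {1..d} N" "p \<noteq> q \<and> aligned p q"
  show "integrable M (\<lambda>\<omega>. component p \<omega> * component q \<omega>)"
    using pq by (intro square_integrable_mult square_integrable_component)
  show "\<bar>\<integral>\<omega>. component p \<omega> * component q \<omega> \<partial>M\<bar> \<le> \<epsilon>"
    using component_orthogonal[OF pq(1,2)] pq(3) assms by (auto simp: L2_inner_def)
qed

end

section \<open>Approximate uniqueness\<close>

text \<open>The common setting of the constructed process and of a competitor: a process that decomposes the
array and is approximately orthogonal on aligned pairs.\<close>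

locale approx_decomposition =
  fixes M :: "'a measure" and d :: nat and N :: "nat set" and X :: "nat set \<Rightarrow> 'a \<Rightarrow> real"
    and Z :: "(nat \<rightharpoonup> nat) \<Rightarrow> 'a \<Rightarrow> real" and \<epsilon> :: real
  assumes eps: "0 \<le> \<epsilon>"
    and process: "real_process M (part_incr {1..d} N) Z"
    and dec: "decomposition M d N X Z"
    and orth: "approx_orthogonal M d N \<epsilon> Z"
    and X_square_integrable: "s \<in> nsets N d \<Longrightarrow> square_integrable M (X s)"
    and X_norm: "s \<in> nsets N d \<Longrightarrow> L2_inner M (X s) (X s) = 1"
begin

lemma Z_measurable: "p \<in> part_incr {1..d} N \<Longrightarrow> Z p \<in> borel_measurable M"
  using process by (simp add: real_process_def)

lemma Z_orth:
  assumes "p \<in> part_incr {1..d} N" "q \<in> part_incr {1..d} N" "p \<noteq> q" "aligned p q"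
  shows "integrable M (\<lambda>\<omega>. Z p \<omega> * Z q \<omega>)" "\<bar>L2_inner M (Z p) (Z q)\<bar> \<le> \<epsilon>"
  using assms orth unfolding approx_orthogonal_def L2_inner_def by blast+

lemma dec_as_map:
  assumes "incr d N f"
  shows "AE \<omega> in M. X (f ` {1..d}) \<omega> = (\<Sum>F\<in>Pow {1..d}. Z (as_map d f |` F) \<omega>)"
  using dec incr_nsets[OF assms] unfolding decomposition_def canon_iso_image[OF assms, symmetric] by blast

lemma aligned_restrictions:
  assumes "incr d N f" "F \<subseteq> {1..d}" "G \<subseteq> {1..d}"
  shows "aligned (as_map d f |` F) (as_map d f |` G)"
  using incr_eq_iff[OF assms(1)] assms(2,3) by (intro aligned_as_map[where D="{1..d}"]) auto

lemma restrictions_neq: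
  assumes "F \<subseteq> {1..d}" "G \<subseteq> {1..d}" "F \<noteq> G"
  shows "as_map d f |` F \<noteq> as_map d f' |` G"
  using assms dom_as_map_restrict by metis

lemma Z_orth_as_map:
  assumes "incr d N f" "F \<in> Pow {1..d}" "G \<in> Pow {1..d}" "F \<noteq> G"
  shows "integrable M (\<lambda>\<omega>. Z (as_map d f |` F) \<omega> * Z (as_map d f |` G) \<omega>)"
    "\<bar>L2_inner M (Z (as_map d f |` F)) (Z (as_map d f |` G))\<bar> \<le> \<epsilon>"
  using Z_orth[OF as_map_restrict_part_incr[OF assms(1)] as_map_restrict_part_incr[OF assms(1)]
      restrictions_neq aligned_restrictions[OF assms(1)], of F G] assms(2-4) by auto

text \<open>Restrictions of one total map are pairwise aligned, so their products are integrable.  The sum of the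
squares is the square of the array variable minus these products, hence integrable, and it dominates each square.\<close>

lemma square_integrable_Z_as_map:
  assumes f: "incr d N f" and F: "F \<in> Pow {1..d}"
  shows "square_integrable M (Z (as_map d f |` F))"
proof -
  let ?P = "Pow {1..d}" and ?z = "\<lambda>F. Z (as_map d f |` F)"
  have meas: "?z G \<in> borel_measurable M" for G
    by (intro Z_measurable as_map_restrict_part_incr f)
  have "integrable M (\<lambda>\<omega>. (X (f ` {1..d}) \<omega>)\<^sup>2)"
    using X_square_integrable[OF incr_nsets[OF f]] by (simp add: square_integrable_def)
  moreover have "AE \<omega> in M. (X (f ` {1..d}) \<omega>)\<^sup>2 = (\<Sum>F\<in>?P. ?z F \<omega>)\<^sup>2"
    using dec_as_map[OF f] by eventually_elim simp
  moreover have "X (f ` {1..d}) \<in> borel_measurable M"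
    using X_square_integrable[OF incr_nsets[OF f]] by (rule square_integrable_measurable)
  ultimately have "integrable M (\<lambda>\<omega>. (\<Sum>F\<in>?P. ?z F \<omega>)\<^sup>2)"
    using meas by (subst (asm) integrable_cong_AE) (auto intro: borel_measurable_sum borel_measurable_power)
  moreover have "integrable M (\<lambda>\<omega>. \<Sum>F\<in>?P. \<Sum>G\<in>?P - {F}. ?z F \<omega> * ?z G \<omega>)"
    by (intro Bochner_Integration.integrable_sum Z_orth_as_map(1)[OF f]) auto
  ultimately have "integrable M (\<lambda>\<omega>. (\<Sum>F\<in>?P. ?z F \<omega>)\<^sup>2 - (\<Sum>F\<in>?P. \<Sum>G\<in>?P - {F}. ?z F \<omega> * ?z G \<omega>))"
    by (rule Bochner_Integration.integrable_diff)
  moreover have "(\<Sum>F\<in>?P. ?z F \<omega>)\<^sup>2 - (\<Sum>F\<in>?P. \<Sum>G\<in>?P - {F}. ?z F \<omega> * ?z G \<omega>)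
      = (\<Sum>F\<in>?P. (?z F \<omega>)\<^sup>2)" for \<omega>
  proof -
    have "(\<Sum>F\<in>?P. ?z F \<omega>)\<^sup>2 = (\<Sum>F\<in>?P. \<Sum>G\<in>?P. ?z F \<omega> * ?z G \<omega>)"
      by (simp add: power2_eq_square sum_product)
    also have "\<dots> = (\<Sum>F\<in>?P. (?z F \<omega>)\<^sup>2 + (\<Sum>G\<in>?P - {F}. ?z F \<omega> * ?z G \<omega>))"
    proof (rule sum.cong[OF refl])
      fix F assume "F \<in> ?P"
      then show "(\<Sum>G\<in>?P. ?z F \<omega> * ?z G \<omega>) = (?z F \<omega>)\<^sup>2 + (\<Sum>G\<in>?P - {F}. ?z F \<omega> * ?z G \<omega>)"
        by (subst sum.remove[of _ F]) (simp_all add: power2_eq_square)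
    qed
    finally show ?thesis by (simp add: sum.distrib)
  qed
  ultimately have int: "integrable M (\<lambda>\<omega>. \<Sum>F\<in>?P. (?z F \<omega>)\<^sup>2)" by simp
  have "integrable M (\<lambda>\<omega>. (?z F \<omega>)\<^sup>2)"
  proof (rule Bochner_Integration.integrable_bound[OF int])
    show "(\<lambda>\<omega>. (?z F \<omega>)\<^sup>2) \<in> borel_measurable M" using meas by (rule borel_measurable_power)
    have "(?z F \<omega>)\<^sup>2 \<le> (\<Sum>F\<in>?P. (?z F \<omega>)\<^sup>2)" for \<omega>
      using F by (intro member_le_sum) auto
    then show "AE \<omega> in M. norm ((?z F \<omega>)\<^sup>2) \<le> norm (\<Sum>F\<in>?P. (?z F \<omega>)\<^sup>2)"
      by (intro AE_I2) (simp add: sum_nonneg)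
  qed
  then show ?thesis using meas by (simp add: square_integrable_def)
qed

lemma sum_norms_le:
  assumes f: "incr d N f"
  shows "(\<Sum>F\<in>Pow {1..d}. L2_inner M (Z (as_map d f |` F)) (Z (as_map d f |` F))) \<le> 1 + 4 ^ d * \<epsilon>"
proof -
  let ?P = "Pow {1..d}" and ?z = "\<lambda>F. Z (as_map d f |` F)"
  have "\<bar>L2_inner M (\<lambda>\<omega>. \<Sum>F\<in>?P. ?z F \<omega>) (\<lambda>\<omega>. \<Sum>F\<in>?P. ?z F \<omega>) - (\<Sum>F\<in>?P. L2_inner M (?z F) (?z F))\<bar>
      \<le> (real (card ?P))\<^sup>2 * \<epsilon>"
    using Z_orth_as_map(2)[OF f] square_integrable_Z_as_map[OF f] eps
    by (intro L2_inner_sum_almost_orthogonal) auto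
  moreover have "(real (card ?P))\<^sup>2 = 4 ^ d"
    by (simp add: card_Pow power2_eq_square flip: power_mult_distrib)
  moreover have "L2_inner M (\<lambda>\<omega>. \<Sum>F\<in>?P. ?z F \<omega>) (\<lambda>\<omega>. \<Sum>F\<in>?P. ?z F \<omega>) = 1"
  proof -
    have "L2_inner M (X (f ` {1..d})) (X (f ` {1..d}))
        = L2_inner M (\<lambda>\<omega>. \<Sum>F\<in>?P. ?z F \<omega>) (\<lambda>\<omega>. \<Sum>F\<in>?P. ?z F \<omega>)"
      using dec_as_map[OF f] X_square_integrable[OF incr_nsets[OF f]] square_integrable_Z_as_map[OF f]
      by (intro L2_inner_cong_AE square_integrable_measurable square_integrable_sum) auto
    then show ?thesis using X_norm[OF incr_nsets[OF f]] by simp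
  qed
  ultimately show ?thesis by simp
qed

text \<open>Average the decomposition over the \<open>R\<close> extensions of \<open>p\<close>.  The terms at restrictions of \<open>p\<close> are the
same for all extensions.  Every other term belongs to a map that uses a new index; these maps are distinct for
different extensions or different domains, and pairwise aligned, so the average of these terms is small by the
approximate theorem of Pythagoras.\<close>

lemma average_close:
  fixes f :: "nat \<Rightarrow> nat \<Rightarrow> nat" and p :: "nat \<rightharpoonup> nat"
  assumes R: "R > 0" and D: "dom p \<subseteq> {1..d}"
    and f: "\<And>r. r < R \<Longrightarrow> incr d N (f r)"
    and ext: "\<And>r i. r < R \<Longrightarrow> i \<in> dom p \<Longrightarrow> p i = Some (f r i)"
    and only: "\<And>r r' i j. r < R \<Longrightarrow> r' < R \<Longrightarrow> r \<noteq> r' \<Longrightarrow> i \<in> {1..d} \<Longrightarrow> j \<in> {1..d} \<Longrightarrow>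
      f r i = f r' j \<Longrightarrow> i = j \<and> i \<in> dom p"
    and W: "W = (\<lambda>\<omega>. (1 / R) * (\<Sum>r<R. X (f r ` {1..d}) \<omega>) - (\<Sum>H\<in>Pow (dom p). Z (p |` H) \<omega>))"
  shows "square_integrable M W" "L2_inner M W W \<le> (1 + 4 ^ d * \<epsilon>) / R + 4 ^ d * \<epsilon>"
proof -
  let ?P = "Pow {1..d}" and ?D = "Pow (dom p)"
  define T where "T = (?P - ?D) \<times> {..<R}"
  define w where "w t = Z (as_map d (f (snd t)) |` fst t)" for t
  have finT: "finite T" by (simp add: T_def)
  have si_w: "square_integrable M (w t)" if "t \<in> T" for t
    unfolding w_def using that by (intro square_integrable_Z_as_map f) (auto simp: T_def)
  have restr: "as_map d (f r) |` H = p |` H" if "r < R" "H \<in> ?D" for r H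
  proof
    fix i
    show "(as_map d (f r) |` H) i = (p |` H) i"
    proof (cases "i \<in> H")
      case True
      then have "i \<in> dom p" using that(2) by blast
      moreover from this have "i \<in> {1..d}" using D by blast
      ultimately show ?thesis using ext[OF that(1)] True by (simp add: as_map_def restrict_map_def)
    qed (simp add: restrict_map_def)
  qed
  have si_p: "square_integrable M (Z (p |` H))" if "H \<in> ?D" for H
    using square_integrable_Z_as_map[OF f[OF R], of H] restr[OF R that] that D by auto
  show siW: "square_integrable M W"
    unfolding W using f X_square_integrable[OF incr_nsets] si_p
    by (intro square_integrable_diff square_integrable_cmult square_integrable_sum) auto
  have orth: "\<bar>L2_inner M (w t) (w t')\<bar> \<le> \<epsilon>" if t: "t \<in> T" "t' \<in> T" "t \<noteq> t'" for t t'
  proof -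
    obtain G r G' r' where eq: "t = (G, r)" "t' = (G', r')" by fastforce
    have G: "G \<subseteq> {1..d}" "G' \<subseteq> {1..d}" "\<not> G \<subseteq> dom p" and r: "r < R" "r' < R"
      using t(1,2) by (auto simp: eq T_def)
    have "as_map d (f r) |` G \<noteq> as_map d (f r') |` G' \<and> aligned (as_map d (f r) |` G) (as_map d (f r') |` G')"
    proof (cases "r = r'")
      case True
      then show ?thesis
        using t(3) eq G aligned_restrictions[OF f[OF r(1)] G(1,2)] restrictions_neq[OF G(1,2)] by auto
    next
      case False
      have "as_map d (f r) |` G \<noteq> as_map d (f r') |` G'"
      proof
        assume *: "as_map d (f r) |` G = as_map d (f r') |` G'"
        then have "G = G'" using dom_as_map_restrict G by metis
        from G obtain i where i: "i \<in> G" "i \<notin> dom p" "i \<in> {1..d}" by blast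
        have "(as_map d (f r) |` G) i = (as_map d (f r') |` G) i" using * \<open>G = G'\<close> by simp
        then have "f r i = f r' i" using i by (simp add: as_map_def)
        with only[OF r False i(3) i(3)] i(2) show False by blast
      qed
      moreover have "aligned (as_map d (f r) |` G) (as_map d (f r') |` G')"
      proof (rule aligned_as_map[where D="dom p", OF _ _ G(1,2)])
        fix i assume "i \<in> dom p"
        then show "f r i = f r' i" using ext[OF r(1)] ext[OF r(2)] by fastforce
      qed (use only[OF r False] in blast)
      ultimately show ?thesis ..
    qed
    then show ?thesis
      unfolding w_def eq using r by (auto intro!: Z_orth(2) as_map_restrict_part_incr f)
  qed
  have "AE \<omega> in M. \<forall>r\<in>{..<R}. X (f r ` {1..d}) \<omega> = (\<Sum>F\<in>?P. Z (as_map d (f r) |` F) \<omega>)"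
    using dec_as_map[OF f] by (intro AE_finite_allI) auto
  then have "AE \<omega> in M. W \<omega> = (1 / R) * (\<Sum>t\<in>T. w t \<omega>)"
  proof eventually_elim
    case (elim \<omega>)
    have "(\<Sum>r<R. X (f r ` {1..d}) \<omega>) = (\<Sum>r<R. (\<Sum>G\<in>?P - ?D. Z (as_map d (f r) |` G) \<omega>) + (\<Sum>H\<in>?D. Z (p |` H) \<omega>))"
    proof (rule sum.cong[OF refl])
      fix r assume r: "r \<in> {..<R}"
      have "(\<Sum>F\<in>?P. Z (as_map d (f r) |` F) \<omega>)
          = (\<Sum>G\<in>?P - ?D. Z (as_map d (f r) |` G) \<omega>) + (\<Sum>H\<in>?D. Z (as_map d (f r) |` H) \<omega>)"
        using D by (intro sum.subset_diff) auto
      also have "(\<Sum>H\<in>?D. Z (as_map d (f r) |` H) \<omega>) = (\<Sum>H\<in>?D. Z (p |` H) \<omega>)"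
        using r by (intro sum.cong refl) (simp add: restr)
      finally show "X (f r ` {1..d}) \<omega> = (\<Sum>G\<in>?P - ?D. Z (as_map d (f r) |` G) \<omega>) + (\<Sum>H\<in>?D. Z (p |` H) \<omega>)"
        using elim r by simp
    qed
    also have "\<dots> = (\<Sum>r<R. \<Sum>G\<in>?P - ?D. Z (as_map d (f r) |` G) \<omega>) + R * (\<Sum>H\<in>?D. Z (p |` H) \<omega>)"
      by (simp add: sum.distrib)
    also have "(\<Sum>r<R. \<Sum>G\<in>?P - ?D. Z (as_map d (f r) |` G) \<omega>) = (\<Sum>t\<in>T. w t \<omega>)"
      unfolding T_def w_def by (subst sum.swap) (simp add: sum.cartesian_product case_prod_beta)
    finally show ?case using R by (simp add: W field_simps)
  qed
  then have "L2_inner M W W = L2_inner M (\<lambda>\<omega>. (1 / R) * (\<Sum>t\<in>T. w t \<omega>)) (\<lambda>\<omega>. (1 / R) * (\<Sum>t\<in>T. w t \<omega>))"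
    by (intro L2_inner_cong_AE square_integrable_measurable siW square_integrable_cmult square_integrable_sum si_w)
  also have "\<dots> = (1 / R) * ((1 / R) * L2_inner M (\<lambda>\<omega>. \<Sum>t\<in>T. w t \<omega>) (\<lambda>\<omega>. \<Sum>t\<in>T. w t \<omega>))"
    by (simp only: L2_inner_cmult_left L2_inner_cmult_right)
  also have "\<dots> \<le> (1 / R) * ((1 / R) * (R * (1 + 4 ^ d * \<epsilon>) + 4 ^ d * (real R)\<^sup>2 * \<epsilon>))"
  proof (intro mult_left_mono)
    have "L2_inner M (\<lambda>\<omega>. \<Sum>t\<in>T. w t \<omega>) (\<lambda>\<omega>. \<Sum>t\<in>T. w t \<omega>) \<le> (\<Sum>t\<in>T. L2_inner M (w t) (w t)) + (real (card T))\<^sup>2 * \<epsilon>"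
    proof -
      have "\<bar>L2_inner M (\<lambda>\<omega>. \<Sum>t\<in>T. w t \<omega>) (\<lambda>\<omega>. \<Sum>t\<in>T. w t \<omega>) - (\<Sum>t\<in>T. L2_inner M (w t) (w t))\<bar>
          \<le> (real (card T))\<^sup>2 * \<epsilon>"
        by (rule L2_inner_sum_almost_orthogonal[OF finT _ eps]; (rule si_w orth, assumption+))
      then show ?thesis by linarith
    qed
    also have "(\<Sum>t\<in>T. L2_inner M (w t) (w t))
        = (\<Sum>r<R. \<Sum>G\<in>?P - ?D. L2_inner M (Z (as_map d (f r) |` G)) (Z (as_map d (f r) |` G)))"
      unfolding T_def w_def by (subst sum.swap) (simp add: sum.cartesian_product case_prod_beta)
    also have "\<dots> \<le> (\<Sum>r<R. 1 + 4 ^ d * \<epsilon>)"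
    proof (rule sum_mono)
      fix r assume r: "r \<in> {..<R}"
      have "(\<Sum>G\<in>?P - ?D. L2_inner M (Z (as_map d (f r) |` G)) (Z (as_map d (f r) |` G)))
          \<le> (\<Sum>G\<in>?P. L2_inner M (Z (as_map d (f r) |` G)) (Z (as_map d (f r) |` G)))"
        by (intro sum_mono2) (auto simp: L2_inner_self_nonneg)
      also have "\<dots> \<le> 1 + 4 ^ d * \<epsilon>" using r by (intro sum_norms_le f) simp
      finally show "(\<Sum>G\<in>?P - ?D. L2_inner M (Z (as_map d (f r) |` G)) (Z (as_map d (f r) |` G))) \<le> 1 + 4 ^ d * \<epsilon>" .
    qed
    also have "(\<Sum>r<R. 1 + 4 ^ d * \<epsilon>) = R * (1 + 4 ^ d * \<epsilon>)" by simp
    also have "(real (card T))\<^sup>2 * \<epsilon> \<le> (2 ^ d * real R)\<^sup>2 * \<epsilon>"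
    proof (intro mult_right_mono power_mono)
      have "card (?P - ?D) \<le> card ?P" by (intro card_mono) auto
      then have "card T \<le> 2 ^ d * R" by (simp add: T_def card_cartesian_product card_Pow)
      then have "real (card T) \<le> real (2 ^ d * R)" by (rule of_nat_mono)
      then show "real (card T) \<le> 2 ^ d * real R" by simp
    qed (use eps in auto)
    also have "(2 ^ d * real R)\<^sup>2 = 4 ^ d * (real R)\<^sup>2"
      by (simp add: power_mult_distrib power2_eq_square flip: power_mult_distrib)
    finally show "L2_inner M (\<lambda>\<omega>. \<Sum>t\<in>T. w t \<omega>) (\<lambda>\<omega>. \<Sum>t\<in>T. w t \<omega>)
        \<le> R * (1 + 4 ^ d * \<epsilon>) + 4 ^ d * (real R)\<^sup>2 * \<epsilon>" by simp
  qed auto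
  also have "\<dots> = (1 + 4 ^ d * \<epsilon>) / R + 4 ^ d * \<epsilon>"
    using R by (simp add: field_simps power2_eq_square)
  finally show "L2_inner M W W \<le> (1 + 4 ^ d * \<epsilon>) / R + 4 ^ d * \<epsilon>" .
qed

end

text \<open>For each \<open>G\<close> the sums of \<open>Z1\<close> and of \<open>Z2\<close> over the restrictions of \<open>p |` G\<close> are both close to the same average
of the array, hence close to each other.  The difference of \<open>Z1\<close> and \<open>Z2\<close> at \<open>p\<close> is an alternating sum of at most \<open>2 ^ d\<close> such
differences.\<close>

lemma approx_decomposition_unique:
  assumes Z1: "approx_decomposition M d N X Z1 \<epsilon>" and Z2: "approx_decomposition M d N X Z2 \<epsilon>"
    and c: "c > 0" and d: "1 \<le> d" and l: "1 \<le> l" and R: "R > 0" "R * d < q"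
    and L: "L = (*) (c * q) ` {1..l}" and N: "(*) c ` {1..l * q + R * d - 1} \<subseteq> N"
    and p: "p \<in> part_incr {1..d} L"
  shows "square_integrable M (\<lambda>\<omega>. Z1 p \<omega> - Z2 p \<omega>)"
    "L2_inner M (\<lambda>\<omega>. Z1 p \<omega> - Z2 p \<omega>) (\<lambda>\<omega>. Z1 p \<omega> - Z2 p \<omega>)
      \<le> 4 ^ d * (4 * ((1 + 4 ^ d * \<epsilon>) / R + 4 ^ d * \<epsilon>))"
proof -
  interpret Z1: approx_decomposition M d N X Z1 \<epsilon> by (rule Z1)
  interpret Z2: approx_decomposition M d N X Z2 \<epsilon> by (rule Z2)
  let ?b = "(1 + 4 ^ d * \<epsilon>) / R + 4 ^ d * \<epsilon>"
  let ?D = "dom p"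
  define S where "S Z G \<omega> = (\<Sum>H\<in>Pow G. Z (p |` H) \<omega>)" for Z :: "(nat \<rightharpoonup> nat) \<Rightarrow> 'a \<Rightarrow> real" and G \<omega>
  define V where "V G \<omega> = S Z1 G \<omega> - S Z2 G \<omega>" for G \<omega>
  have D: "?D \<subseteq> {1..d}" "finite ?D"
    using part_incr_dom[OF p] finite_subset[of ?D "{1..d}"] by auto
  have V: "square_integrable M (V G) \<and> L2_inner M (V G) (V G) \<le> 4 * ?b" if G: "G \<in> Pow ?D" for G
  proof -
    let ?p = "p |` G"
    have p': "?p \<in> part_incr {1..d} L" using p by (rule part_incr_restrict)
    have domp: "dom ?p = G" using G by auto
    have inc: "incr d N (fill d c ?p r)" if "r < R" for r
      using fill_incr[OF p'[unfolded L] c that _ l d] R N by (auto intro: incr_mono)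
    have ext: "?p i = Some (fill d c ?p r i)" if "r < R" "i \<in> dom ?p" for r i
    proof -
      have "1 \<le> i" using that(2) part_incr_dom[OF p'] by auto
      from fill_dom[OF this that(2)] that(2) show ?thesis by auto
    qed
    have only: "i = j \<and> i \<in> dom ?p"
      if r: "r < R" "r' < R" "r \<noteq> r'" and i: "i \<in> {1..d}" and j: "j \<in> {1..d}"
        and eq: "fill d c ?p r i = fill d c ?p r' j" for r r' i j
    proof -
      have i': "i \<in> dom ?p"
        using filler_disjoint[OF p'[unfolded L] p'[unfolded L] c r(1,2) R(2) r(3), of i j] i j eq by auto
      have j': "j \<in> dom ?p"
        using filler_disjoint[OF p'[unfolded L] p'[unfolded L] c r(2,1) R(2) r(3)[symmetric], of j i] i j eq by auto
      have "the (?p i) = the (?p j)" using eq ext[OF r(1) i'] ext[OF r(2) j'] by simp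
      with part_incr_eq_iff[OF p' i' j'] i' show ?thesis by simp
    qed
    define W where "W Z = (\<lambda>\<omega>. (1 / R) * (\<Sum>r<R. X (fill d c ?p r ` {1..d}) \<omega>)
        - (\<Sum>H\<in>Pow (dom ?p). Z (?p |` H) \<omega>))" for Z :: "(nat \<rightharpoonup> nat) \<Rightarrow> 'a \<Rightarrow> real"
    have dom_sub: "dom ?p \<subseteq> {1..d}" using part_incr_dom[OF p'] .
    have W1: "square_integrable M (W Z1)" "L2_inner M (W Z1) (W Z1) \<le> ?b"
      by (rule Z1.average_close[OF R(1) dom_sub _ _ _ W_def]; (rule inc ext only, assumption+))+
    have W2: "square_integrable M (W Z2)" "L2_inner M (W Z2) (W Z2) \<le> ?b"
      by (rule Z2.average_close[OF R(1) dom_sub _ _ _ W_def]; (rule inc ext only, assumption+))+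
    have S: "S Z G \<omega> = (\<Sum>H\<in>Pow (dom ?p). Z (?p |` H) \<omega>)" for Z \<omega>
      unfolding S_def domp by (intro sum.cong refl) (simp add: inf_absorb2)
    have VW: "V G = (\<lambda>\<omega>. W Z2 \<omega> - W Z1 \<omega>)"
      by (simp add: V_def W_def S fun_eq_iff)
    have "L2_inner M (V G) (V G) \<le> 2 * (L2_inner M (W Z2) (W Z2) + L2_inner M (W Z1) (W Z1))"
      unfolding VW using W2(1) W1(1) by (rule L2_inner_diff_self_le)
    also have "\<dots> \<le> 2 * (?b + ?b)" by (intro mult_left_mono add_mono W2(2) W1(2)) simp
    also have "\<dots> = 4 * ?b" by simp
    finally show ?thesis
      unfolding VW using square_integrable_diff[OF W2(1) W1(1)] by blast
  qed
  let ?s = "\<lambda>G. (-1) ^ card (?D - G) :: real"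
  have eq: "(\<lambda>\<omega>. Z1 p \<omega> - Z2 p \<omega>) = (\<lambda>\<omega>. \<Sum>G\<in>Pow ?D. ?s G * V G \<omega>)"
  proof
    fix \<omega>
    have *: "alt_sum (\<lambda>G. S Z G \<omega>) ?D = Z p \<omega>" for Z
    proof -
      have "alt_sum (\<lambda>G. S Z G \<omega>) ?D = Z (p |` ?D) \<omega>"
        unfolding S_def using D(2) by (rule alt_sum_sum)
      also have "p |` ?D = p" by (auto simp: fun_eq_iff restrict_map_def domIff)
      finally show ?thesis .
    qed
    have "Z1 p \<omega> - Z2 p \<omega> = alt_sum (\<lambda>G. V G \<omega>) ?D"
      unfolding V_def alt_sum_diff * by (rule refl)
    then show "Z1 p \<omega> - Z2 p \<omega> = (\<Sum>G\<in>Pow ?D. ?s G * V G \<omega>)" by (simp add: alt_sum_def)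
  qed
  show "square_integrable M (\<lambda>\<omega>. Z1 p \<omega> - Z2 p \<omega>)"
    unfolding eq using V by (intro square_integrable_sum square_integrable_cmult) blast
  have "\<bar>L2_inner M (\<lambda>\<omega>. \<Sum>G\<in>Pow ?D. ?s G * V G \<omega>) (\<lambda>\<omega>. \<Sum>G\<in>Pow ?D. ?s G * V G \<omega>)\<bar>
      \<le> real (card (Pow ?D)) * real (card (Pow ?D)) * (4 * ?b)"
  proof (rule abs_L2_inner_combination_le)
    fix G H assume "G \<in> Pow ?D" "H \<in> Pow ?D"
    note GH = V[OF this(1)] V[OF this(2)]
    have "\<bar>L2_inner M (V G) (V H)\<bar> \<le> (L2_inner M (V G) (V G) + L2_inner M (V H) (V H)) / 2"
      using abs_L2_inner_le[of M "V G" "V H" 1] GH by simp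
    also have "\<dots> \<le> (4 * ?b + 4 * ?b) / 2" using GH by (intro divide_right_mono add_mono) auto
    also have "\<dots> = 4 * ?b" by simp
    finally show "\<bar>L2_inner M (V G) (V H)\<bar> \<le> 4 * ?b" .
  qed (use V in \<open>auto simp: power_abs\<close>)
  also have "\<dots> \<le> 2 ^ d * 2 ^ d * (4 * ?b)"
  proof -
    have "card ?D \<le> d" using card_mono[OF _ D(1)] by simp
    then have "real (card (Pow ?D)) \<le> 2 ^ d" using D(2) by (simp add: card_Pow)
    then show ?thesis using Z1.eps by (intro mult_right_mono mult_mono) auto
  qed
  also have "(2::real) ^ d * 2 ^ d = 4 ^ d" by (simp flip: power_mult_distrib)
  finally show "L2_inner M (\<lambda>\<omega>. Z1 p \<omega> - Z2 p \<omega>) (\<lambda>\<omega>. Z1 p \<omega> - Z2 p \<omega>) \<le> 4 ^ d * (4 * ?b)"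
    unfolding eq by linarith
qed

section \<open>Choice of the parameters\<close>

text \<open>With \<open>u\<close> the reciprocal of the \<open>(d + 1)\<close>-st root of \<open>\<epsilon>\<close>, all real powers become
powers of \<open>u\<close> with natural exponents.\<close>

lemma root_bound_bases:
  assumes \<epsilon>: "0 < \<epsilon>" "\<epsilon> \<le> 1" and n: "real n \<ge> n0_const d \<epsilon>"
  obtains u where "u \<ge> 1" "\<epsilon> = 1 / u ^ (d + 1)" "c_const d \<epsilon> = 1 / (2 ^ 16 * u ^ 4)"
    "2 ^ (20 * (d + 1)) * u ^ (d + 5) \<le> root (d + 1) (real n)"
proof
  define \<delta> where "\<delta> = root (d + 1) \<epsilon>"
  have \<delta>: "0 < \<delta>" "\<delta> \<le> 1" "\<delta> ^ (d + 1) = \<epsilon>"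
    using \<epsilon> by (simp_all add: \<delta>_def real_root_pow_pos)
  show "1 / \<delta> \<ge> 1" using \<delta> by simp
  show "\<epsilon> = 1 / (1 / \<delta>) ^ (d + 1)" using \<delta> by (simp add: power_divide)
  have "\<epsilon> = \<delta> powr real (d + 1)" using \<delta> by (simp only: powr_realpow)
  then have "\<epsilon> powr (4 / real (d + 1)) = \<delta> powr (real (d + 1) * (4 / real (d + 1)))"
    by (simp only: powr_powr)
  also have "real (d + 1) * (4 / real (d + 1)) = real 4"
  proof -
    have ne: "real (d + 1) \<noteq> 0" by simp
    show ?thesis by (simp only: times_divide_eq_right nonzero_mult_div_cancel_left[OF ne] of_nat_numeral)
  qed
  also have "\<delta> powr real 4 = \<delta> ^ 4" using \<delta>(1) by (rule powr_realpow)
  finally show "c_const d \<epsilon> = 1 / (2 ^ 16 * (1 / \<delta>) ^ 4)"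
    by (simp add: c_const_def powr_minus power_divide field_simps)
  have "\<epsilon> powr (- real (d + 5)) = 1 / \<epsilon> ^ (d + 5)"
    using \<epsilon> by (simp only: powr_minus powr_realpow inverse_eq_divide)
  also have "\<dots> = ((1 / \<delta>) ^ (d + 5)) ^ (d + 1)"
    unfolding \<delta>(3)[symmetric] by (simp only: power_mult[symmetric] power_one_over mult.commute)
  finally have "n0_const d \<epsilon> = (2 ^ (20 * (d + 1)) * (1 / \<delta>) ^ (d + 5)) ^ (d + 1)"
    unfolding n0_const_def power_mult_distrib by (simp add: power_mult[symmetric] power2_eq_square mult.assoc)
  then have "root (d + 1) ((2 ^ (20 * (d + 1)) * (1 / \<delta>) ^ (d + 5)) ^ (d + 1)) \<le> root (d + 1) (real n)"
    using n by (simp add: real_root_le_iff)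
  then show "2 ^ (20 * (d + 1)) * (1 / \<delta>) ^ (d + 5) \<le> root (d + 1) (real n)"
    using \<delta> by (subst (asm) real_root_pos2) auto
qed

lemma nat_ceiling_bounds:
  fixes x :: real
  assumes "0 \<le> x"
  shows "x \<le> nat \<lceil>x\<rceil>" "nat \<lceil>x\<rceil> \<le> x + 1"
proof -
  have "real (nat \<lceil>x\<rceil>) = of_int \<lceil>x\<rceil>" using assms by (intro of_nat_nat) simp
  then show "x \<le> nat \<lceil>x\<rceil>" "nat \<lceil>x\<rceil> \<le> x + 1" using ceiling_correct[of x] by linarith+
qed

text \<open>For orthogonality, \<open>k\<close> is taken to be about \<open>(4 ^ (d + 1) * d / \<epsilon>)\<^sup>2\<close>, so the spacing \<open>k * (k * d + 1)\<close> of the set \<open>N\<close> is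
of order \<open>\<epsilon> ^ (- 4)\<close>.  In terms of \<open>u\<close> and of the root \<open>\<nu>\<close> of \<open>n\<close>, the claim that \<open>m\<close> points fit
below \<open>n\<close> reduces to \<open>2 ^ (13 * d + 12) * u ^ (4 * d) \<le> \<nu> ^ d\<close>, which holds with much room to spare.\<close>

lemma parameters_exist:
  assumes d: "1 \<le> d" and \<epsilon>: "0 < \<epsilon>" "\<epsilon> \<le> 1" and n: "real n \<ge> n0_const d \<epsilon>"
  obtains k m :: nat where "k > 0" "4 ^ d * (4 * real d / sqrt k) \<le> \<epsilon>"
    "k * (k * d + 1) * (m + 1) \<le> n" "c_const d \<epsilon> * root (d + 1) (real n) \<le> m"
    "2 ^ (20 * d + 4) / \<epsilon> \<le> m"
proof -
  obtain u where u: "u \<ge> 1" "\<epsilon> = 1 / u ^ (d + 1)" "c_const d \<epsilon> = 1 / (2 ^ 16 * u ^ 4)"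
    and \<nu>0: "2 ^ (20 * (d + 1)) * u ^ (d + 5) \<le> root (d + 1) (real n)"
    using root_bound_bases[OF \<epsilon> n] .
  define \<nu> where "\<nu> = root (d + 1) (real n)"
  have \<nu>n: "\<nu> ^ (d + 1) = n" by (simp add: \<nu>_def real_root_pow_pos2)
  have u0: "u > 0" using u(1) by simp
  have "1 \<le> u ^ j" for j using u(1) by (rule one_le_power)
  note u_ge = this
  define A where "A = 4 ^ (d + 1) * real d * u ^ (d + 1)"
  have "1 * 1 * 1 \<le> A" unfolding A_def
  proof (intro mult_mono)
    show "(1::real) \<le> 4 ^ (d + 1)" by (rule one_le_power) simp
  qed (use d u_ge in auto)
  then have A: "1 \<le> A" by simp
  define k where "k = nat \<lceil>A\<^sup>2\<rceil>"
  have A2: "1 \<le> A\<^sup>2" using A by (rule one_le_power)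
  have k: "A\<^sup>2 \<le> k" "k \<le> A\<^sup>2 + 1" using nat_ceiling_bounds[of "A\<^sup>2"] by (simp_all add: k_def)
  have kpos: "k > 0" using k(1) A2 by (cases k) auto
  have kA: "k \<le> 2 * A\<^sup>2" using k(2) A2 by linarith
  have "A \<le> sqrt k" using k(1) A by (simp add: real_le_rsqrt)
  then have "4 ^ d * (4 * real d) / sqrt k \<le> 4 ^ d * (4 * real d) / A"
    using A kpos by (intro divide_left_mono mult_pos_pos) auto
  also have "\<dots> = \<epsilon>" using d u0 by (simp add: A_def u(2) power_add field_simps)
  finally have ortho: "4 ^ d * (4 * real d / sqrt k) \<le> \<epsilon>" by simp
  define m where "m = nat \<lceil>c_const d \<epsilon> * \<nu>\<rceil>"
  have c\<nu>: "c_const d \<epsilon> * \<nu> \<ge> 2 ^ (20 * d + 4) * u ^ (d + 1)"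
  proof -
    have "20 * (d + 1) = 16 + (20 * d + 4)" "d + 5 = 4 + (d + 1)" by simp_all
    then have "2 ^ (20 * (d + 1)) * u ^ (d + 5) = (2 ^ 16 * u ^ 4) * (2 ^ (20 * d + 4) * u ^ (d + 1))"
      by (simp only: power_add mult_ac)
    then have "(2 ^ 16 * u ^ 4) * (2 ^ (20 * d + 4) * u ^ (d + 1)) \<le> \<nu>" using \<nu>0 by (simp add: \<nu>_def)
    then show ?thesis using u0 by (simp add: u(3) field_simps)
  qed
  have "(2::real) ^ 1 \<le> 2 ^ (20 * d + 4)" by (intro power_increasing) auto
  then have "2 * 1 \<le> 2 ^ (20 * d + 4) * u ^ (d + 1)" using u_ge by (intro mult_mono) auto
  then have c2: "2 \<le> c_const d \<epsilon> * \<nu>" using c\<nu> by linarith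
  have m: "c_const d \<epsilon> * \<nu> \<le> m" "m \<le> c_const d \<epsilon> * \<nu> + 1"
    using nat_ceiling_bounds[of "c_const d \<epsilon> * \<nu>"] c2 by (simp_all add: m_def)
  have m1: "real (m + 1) \<le> 2 * (c_const d \<epsilon> * \<nu>)" using m c2 by simp
  have "real (k * (k * d + 1)) \<le> real k * (2 * real k * d)"
  proof -
    have "1 \<le> k * d" using kpos d by (simp add: Suc_le_eq One_nat_def)
    then have "k * d + 1 \<le> 2 * k * d" unfolding mult.assoc by linarith
    then have "k * (k * d + 1) \<le> k * (2 * k * d)" by (rule mult_le_mono2)
    then have "real (k * (k * d + 1)) \<le> real (k * (2 * k * d))" by (rule of_nat_mono)
    then show ?thesis by simp
  qed
  also have "\<dots> = 2 * real d * (real k)\<^sup>2" by (simp add: power2_eq_square)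
  also have "\<dots> \<le> 2 * real d * (2 * A\<^sup>2)\<^sup>2" using kA by (intro mult_left_mono power_mono) auto
  also have "\<dots> = 8 * real d * A ^ 4" by (simp add: power_mult_distrib)
  also have "A ^ 4 = 4 ^ (4 * (d + 1)) * real d ^ 4 * u ^ (4 * (d + 1))"
    by (simp add: A_def power_mult_distrib power_mult[symmetric] mult.commute)
  also have "8 * real d * (4 ^ (4 * (d + 1)) * real d ^ 4 * u ^ (4 * (d + 1)))
      \<le> 8 * 2 ^ d * (4 ^ (4 * (d + 1)) * (2 ^ d) ^ 4 * u ^ (4 * (d + 1)))"
  proof -
    have "real d \<le> 2 ^ d" by (rule order.strict_implies_order[OF of_nat_less_two_power])
    then show ?thesis using u0 by (intro mult_mono power_mono) auto
  qed
  also have "\<dots> = 2 ^ (13 * d + 11) * u ^ (4 * (d + 1))"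
  proof -
    have "(4::real) ^ (4 * (d + 1)) = 2 ^ (2 * (4 * (d + 1)))" by (subst power_mult) simp
    moreover have "((2::real) ^ d) ^ 4 = 2 ^ (4 * d)" by (simp add: power_mult[symmetric] mult.commute)
    moreover have "(8::real) * 2 ^ d * (2 ^ (2 * (4 * (d + 1))) * 2 ^ (4 * d)) = 2 ^ (3 + d + (2 * (4 * (d + 1)) + 4 * d))"
      by (simp only: power_add) simp
    moreover have "3 + d + (2 * (4 * (d + 1)) + 4 * d) = 13 * d + 11" by simp
    ultimately show ?thesis by (simp add: mult.assoc)
  qed
  finally have kQ: "real (k * (k * d + 1)) \<le> 2 ^ (13 * d + 11) * u ^ (4 * (d + 1))" .
  have "real (k * (k * d + 1)) * real (m + 1)
      \<le> (2 ^ (13 * d + 11) * u ^ (4 * (d + 1))) * (2 * (c_const d \<epsilon> * \<nu>))"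
    using kQ m1 u0 by (intro mult_mono) auto
  also have "\<dots> = 2 ^ (13 * d + 12) * u ^ (4 * d) / 2 ^ 16 * \<nu>"
    using u0 by (simp add: u(3) power_add field_simps)
  also have "\<dots> \<le> \<nu> ^ d * \<nu>"
  proof (rule mult_right_mono)
    have "2 ^ (13 * d + 12) * u ^ (4 * d) / 2 ^ 16 \<le> 2 ^ (13 * d + 12) * u ^ (4 * d) / 1"
      using u0 by (intro divide_left_mono) auto
    also have "\<dots> \<le> 2 ^ (20 * (d + 1) * d) * u ^ ((d + 5) * d)"
    proof -
      have "d * 1 \<le> d * d" using d by (intro mult_le_mono2)
      then have dd: "d \<le> d * d" by simp
      have eqs: "20 * (d + 1) * d = 20 * (d * d) + 20 * d" "(d + 5) * d = d * d + 5 * d"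
        by (simp_all add: algebra_simps)
      have le: "13 * d + 12 \<le> 20 * (d + 1) * d" "4 * d \<le> (d + 5) * d"
        unfolding eqs using d dd by linarith+
      have "(2::real) ^ (13 * d + 12) \<le> 2 ^ (20 * (d + 1) * d)"
        using le(1) by (rule power_increasing) simp
      moreover have "u ^ (4 * d) \<le> u ^ ((d + 5) * d)"
        using le(2) u(1) by (rule power_increasing)
      ultimately have "2 ^ (13 * d + 12) * u ^ (4 * d) \<le> 2 ^ (20 * (d + 1) * d) * u ^ ((d + 5) * d)"
        by (rule mult_mono) (use u0 in auto)
      then show ?thesis by simp
    qed
    also have "\<dots> = (2 ^ (20 * (d + 1)) * u ^ (d + 5)) ^ d"
      by (simp add: power_mult_distrib power_mult)
    also have "\<dots> \<le> \<nu> ^ d" using \<nu>0 u0 by (intro power_mono) (auto simp: \<nu>_def)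
    finally show "2 ^ (13 * d + 12) * u ^ (4 * d) / 2 ^ 16 \<le> \<nu> ^ d" .
  qed (simp add: \<nu>_def)
  also have "\<dots> = n" using \<nu>n by (simp add: mult.commute power_add)
  finally have "real (k * (k * d + 1) * (m + 1)) \<le> real n" by (simp only: of_nat_mult)
  then have room: "k * (k * d + 1) * (m + 1) \<le> n" by (simp only: of_nat_le_iff)
  have "2 ^ (20 * d + 4) / \<epsilon> = 2 ^ (20 * d + 4) * u ^ (d + 1)" by (simp add: u(2))
  then have "2 ^ (20 * d + 4) / \<epsilon> \<le> m" using c\<nu> m by linarith
  then show ?thesis using that[OF kpos ortho room] m(1) by (simp add: \<nu>_def)
qed

text \<open>The set \<open>L\<close> has spacing \<open>R * d + 1\<close> inside \<open>N\<close>.  As \<open>R\<close> need only be about \<open>\<kappa> / 4\<close>, this spacing is at most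
\<open>13 / 20\<close> of the permitted \<open>\<kappa> * d\<close>; the surplus compensates for rounding and for the points lost at the end.\<close>

lemma subset_size:
  fixes \<kappa> :: real and d m :: nat
  assumes d: "1 \<le> d" and \<kappa>: "5 \<le> \<kappa>" and m: "4 * (\<kappa> * d) \<le> m"
  obtains R l :: nat where "R > 0" "\<kappa> / 4 \<le> R" "1 \<le> l" "l * (R * d + 1) + R * d - 1 \<le> m"
    "inverse (\<kappa> * d) * m \<le> l"
proof -
  define R where "R = nat \<lceil>\<kappa> / 4\<rceil>"
  have R: "\<kappa> / 4 \<le> R" "R \<le> \<kappa> / 4 + 1"
    using nat_ceiling_bounds[of "\<kappa> / 4"] \<kappa> by (simp_all add: R_def)
  have Rpos: "R > 0" using R(1) \<kappa> by (cases R) auto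
  define q where "q = R * d + 1"
  define a where "a = (m + 2) div q"
  have qpos: "q > 0" by (simp add: q_def)
  have "q * a + (m + 2) mod q = m + 2" by (simp add: a_def)
  moreover have "(m + 2) mod q < q" using qpos by simp
  moreover have "q * (a + 1) = q * a + q" by (simp only: distrib_left mult_1_right)
  ultimately have qa: "q * a \<le> m + 2" "m + 2 < q * (a + 1)" by linarith+
  have kd: "0 < \<kappa> * d" using \<kappa> d by simp
  have "real q = real R * d + 1" by (simp add: q_def)
  also have "\<dots> \<le> (\<kappa> / 4 + 1) * d + d" using R d by (intro add_mono mult_right_mono) auto
  also have "\<dots> \<le> (13 / 20) * (\<kappa> * d)"
  proof -
    have "(\<kappa> / 4 + 2) * d \<le> (13 / 20 * \<kappa>) * d" using \<kappa> by (intro mult_right_mono) auto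
    then show ?thesis by (simp add: algebra_simps)
  qed
  finally have q: "real q \<le> (13 / 20) * (\<kappa> * d)" .
  define x where "x = m / (\<kappa> * d)"
  have x: "4 \<le> x" using m kd by (simp add: x_def pos_le_divide_eq)
  have "x * (\<kappa> * d) = m"
    using iffD1[OF nonzero_eq_divide_eq[OF less_imp_neq[OF kd, THEN not_sym]] x_def] .
  also have "m < real q * (real a + 1)" using qa(2) by (metis add_lessD1 of_nat_1 of_nat_add of_nat_less_iff of_nat_mult)
  also have "\<dots> \<le> (13 / 20) * (\<kappa> * d) * (real a + 1)" using q by (intro mult_right_mono) auto
  also have "\<dots> = ((13 / 20) * (real a + 1)) * (\<kappa> * d)" by (simp add: algebra_simps)
  finally have "x < (13 / 20) * (real a + 1)" using kd by (simp only: mult_less_cancel_right_pos)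
  then have "20 * x < 13 * real a + 13" by simp
  with x have a: "x + 1 \<le> real a" by linarith
  have l: "real (a - 1) = real a - 1" "1 \<le> a - 1" using a x by auto
  have "(a - 1) * q + q = q * a" using l(2) by (cases a) (auto simp: algebra_simps)
  then have "(a - 1) * (R * d + 1) + R * d - 1 \<le> m" using qa(1) by (simp add: q_def)
  moreover have "inverse (\<kappa> * d) * m \<le> real (a - 1)"
    using a l(1) by (simp add: x_def divide_inverse mult.commute)
  ultimately show ?thesis using that[OF Rpos R(1) l(2)] by blast
qed

text \<open>The constant of the uniqueness statement suffices because \<open>4 * d + 2 \<le> (d + 2) * (d + 1)\<close>, with
equality for \<open>d = 1\<close>.\<close>

lemma L2_norm_bound:
  assumes d: "1 \<le> d" and \<epsilon>: "0 \<le> \<epsilon>" and f: "L2_inner M f f \<le> 8 * 16 ^ d * \<epsilon>"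
  shows "L2_norm M f \<le> 2 ^ ((d + 2) choose 2) * sqrt (2 * \<epsilon>)"
proof -
  let ?C = "(d + 2) choose 2"
  have "4 * d + 2 \<le> (d + 2) * (d + 1)" using d mult_le_mono2[OF d, of d] by (simp add: algebra_simps)
  then have "(4 * d + 2) div 2 \<le> (d + 2) * (d + 1) div 2" by (rule div_le_mono)
  moreover have "?C = (d + 2) * (d + 1) div 2"
  proof -
    have "d + 2 - 1 = d + 1" by simp
    then show ?thesis by (simp only: choose_two)
  qed
  moreover have "(4 * d + 2) div 2 = 2 * d + 1" by simp
  ultimately have "2 * d + 1 \<le> ?C" by linarith
  then have "(2::real) ^ (4 * d + 2) \<le> 2 ^ (2 * ?C)" by (intro power_increasing) auto
  moreover have "(2::real) ^ (4 * d + 2) = 4 * 16 ^ d" by (simp add: power_add power_mult)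
  moreover have "(2::real) ^ (2 * ?C) = (2 ^ ?C)\<^sup>2" by (simp only: mult.commute[of 2 ?C] power_mult)
  ultimately have *: "4 * (16::real) ^ d \<le> (2 ^ ?C)\<^sup>2" by linarith
  have "L2_norm M f = sqrt (L2_inner M f f)" by (simp add: L2_norm_def L2_inner_self)
  also have "\<dots> \<le> sqrt ((2 ^ ?C)\<^sup>2 * (2 * \<epsilon>))"
  proof (rule real_sqrt_le_mono)
    have "8 * 16 ^ d * \<epsilon> = (4 * 16 ^ d) * (2 * \<epsilon>)" by simp
    also have "\<dots> \<le> (2 ^ ?C)\<^sup>2 * (2 * \<epsilon>)" using * \<epsilon> by (intro mult_right_mono) auto
    finally show "L2_inner M f f \<le> (2 ^ ?C)\<^sup>2 * (2 * \<epsilon>)" using f by linarith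
  qed
  also have "\<dots> = 2 ^ ?C * sqrt (2 * \<epsilon>)" by (simp add: real_sqrt_mult)
  finally show ?thesis .
qed

section \<open>The decomposition theorem\<close>

text \<open>The conclusion of the theorem for a single array and a given set \<open>N\<close>.\<close>

definition has_decomposition ::
  "'a measure \<Rightarrow> nat \<Rightarrow> nat set \<Rightarrow> (nat set \<Rightarrow> 'a \<Rightarrow> real) \<Rightarrow> real \<Rightarrow> bool" where
  "has_decomposition M d N X \<epsilon> \<longleftrightarrow>
     (\<exists>\<Delta>. real_process M (part_incr {1..d} N) \<Delta> \<and>
        decomposition M d N X \<Delta> \<and>
        approx_zero_mean M d N \<epsilon> \<Delta> \<and>
        approx_orthogonal M d N \<epsilon> \<Delta> \<and>
        (\<exists>L \<subseteq> N. real (card L) \<ge> inverse ((inverse \<epsilon> + 2 ^ (2 * d)) * real d) * real (card N) \<and>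
           (\<forall>Z. real_process M (part_incr {1..d} N) Z \<and>
              decomposition M d N X Z \<and> approx_orthogonal M d N \<epsilon> Z \<longrightarrow>
              (\<forall>p\<in>part_incr {1..d} L.
                 square_integrable M (\<lambda>\<omega>. \<Delta> p \<omega> - Z p \<omega>) \<and>
                 L2_norm M (\<lambda>\<omega>. \<Delta> p \<omega> - Z p \<omega>) \<le> 2 ^ ((d + 2) choose 2) * sqrt (2 * \<epsilon>)))))"

lemma unit_spreadable_arrayI:
  assumes "1 \<le> d" "prob_space M" "spreadable M d {1..n} X"
    and "\<forall>s\<in>nsets {1..n} d. square_integrable M (X s) \<and> L2_norm M (X s) = 1"
  shows "unit_spreadable_array M d n X"
proof (intro unit_spreadable_array.intro unit_spreadable_array_axioms.intro)
  fix s assume "s \<in> nsets {1..n} d"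
  then have "square_integrable M (X s)" "sqrt (L2_inner M (X s) (X s)) = 1"
    using assms(4) by (auto simp: L2_norm_def L2_inner_self)
  then show "square_integrable M (X s)" "L2_inner M (X s) (X s) = 1" by auto
qed (use assms in auto)

lemma (in unit_spreadable_array) approx_decompositionI:
  assumes "0 \<le> \<epsilon>" "N \<subseteq> {1..n}" "real_process M (part_incr {1..d} N) Z"
    "decomposition M d N X Z" "approx_orthogonal M d N \<epsilon> Z"
  shows "approx_decomposition M d N X Z \<epsilon>"
proof
  fix s assume "s \<in> nsets N d"
  then have "s \<in> nsets {1..n} d" using assms(2) by (auto simp: nsets_def)
  then show "square_integrable M (X s)" "L2_inner M (X s) (X s) = 1"
    by (rule square_integrable_X, rule norm_X)
qed (use assms in auto)

lemma card_multiples: "0 < c \<Longrightarrow> card ((*) c ` {1..l}) = l" for c l :: nat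
  by (subst card_image) (auto simp: inj_on_def)

text \<open>The choice of \<open>\<kappa>\<close> gives \<open>1 + 4 ^ d * \<epsilon> = \<kappa> * \<epsilon>\<close>, and so \<open>R \<ge> \<kappa> / 4\<close> extensions bring the contribution of the
squares in \<open>average_close\<close> below \<open>4 * \<epsilon> \<le> 4 ^ d * \<epsilon>\<close>.\<close>

lemma (in sparse_array) has_decomposition_N:
  assumes \<epsilon>: "0 < \<epsilon>" "\<epsilon> \<le> 1" and ortho: "4 ^ d * (4 * real d / sqrt k) \<le> \<epsilon>"
    and m: "2 ^ (20 * d + 4) / \<epsilon> \<le> m"
  shows "has_decomposition M d N X \<epsilon>"
proof -
  define \<kappa> :: real where "\<kappa> = inverse \<epsilon> + 2 ^ (2 * d)"
  have inv: "1 \<le> inverse \<epsilon>" using \<epsilon> by (simp add: one_le_inverse_iff)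
  have four: "(4::real) ^ 1 \<le> 4 ^ d" using d_pos by (intro power_increasing) auto
  have pow: "(2::real) ^ (2 * d) = 4 ^ d" by (simp add: power_mult)
  have \<kappa>: "5 \<le> \<kappa>" using inv four by (simp add: \<kappa>_def pow)
  have "4 * (\<kappa> * d) \<le> m"
  proof -
    have "1 * inverse \<epsilon> \<le> 4 ^ d * inverse \<epsilon>" using inv four \<epsilon>(1) by (intro mult_right_mono) auto
    moreover have "(4::real) ^ d * 1 \<le> 4 ^ d * inverse \<epsilon>" using inv by (intro mult_left_mono) auto
    ultimately have "\<kappa> \<le> 2 * 4 ^ d * inverse \<epsilon>" unfolding \<kappa>_def pow by linarith
    moreover have "real d \<le> 2 ^ d" by (rule order.strict_implies_order[OF of_nat_less_two_power])
    ultimately have "4 * (\<kappa> * d) \<le> 4 * ((2 * 4 ^ d * inverse \<epsilon>) * 2 ^ d)"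
      using \<kappa> \<epsilon>(1) by (intro mult_left_mono mult_mono) auto
    also have "\<dots> = 2 ^ (3 * d + 3) / \<epsilon>"
    proof -
      have "(2::real) ^ (3 * d + 3) = 8 * (4 ^ d * 2 ^ d)" by (simp add: power_add power_mult flip: power_mult_distrib)
      then show ?thesis by (simp add: divide_inverse)
    qed
    also have "\<dots> \<le> 2 ^ (20 * d + 4) / \<epsilon>"
      using \<epsilon> by (intro divide_right_mono power_increasing) auto
    finally show ?thesis using m by linarith
  qed
  from subset_size[OF d_pos \<kappa> this] obtain R l :: nat
    where R: "R > 0" "\<kappa> / 4 \<le> R" and l: "1 \<le> l" "l * (R * d + 1) + R * d - 1 \<le> m"
      "inverse (\<kappa> * d) * m \<le> l" .
  define q where "q = R * d + 1"
  define L where "L = (*) (k * Q * q) ` {1..l}"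
  have kQ: "0 < k * Q" using k_pos Q by (cases Q) auto
  have Nsub: "N \<subseteq> {1..n}"
  proof
    fix x assume "x \<in> N"
    then obtain v where "x = k * Q * v" "v \<in> {1..m}" unfolding N_def by (rule imageE)
    then have v: "x = k * Q * v" "1 \<le> v" "v \<le> m" by simp_all
    have "k * Q * v \<le> k * Q * (m + 1)" using v(3) by (intro mult_le_mono2) simp
    then show "x \<in> {1..n}" using v kQ room by (simp add: Suc_le_eq One_nat_def)
  qed
  have lq: "l * q \<le> m"
  proof -
    have "1 \<le> R * d" using R(1) d_pos by (simp add: Suc_le_eq One_nat_def)
    then show ?thesis using l(2) by (simp add: q_def)
  qed
  have fill_N: "(*) (k * Q) ` {1..l * q + R * d - 1} \<subseteq> N"
    unfolding N_def using l(2) by (intro image_mono) (auto simp: q_def)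
  have "L \<subseteq> N"
  proof
    fix x assume "x \<in> L"
    then obtain v where "x = k * Q * q * v" "v \<in> {1..l}" unfolding L_def by (rule imageE)
    then have v: "x = k * Q * (q * v)" "1 \<le> v" "v \<le> l" by (simp_all add: mult.assoc)
    have "q * v \<le> q * l" using v(3) by (rule mult_le_mono2)
    then have "q * v \<le> m" using lq mult.commute[of l q] by linarith
    moreover have "1 \<le> q * v" using v(2) by (simp add: q_def Suc_le_eq One_nat_def)
    ultimately show "x \<in> N" unfolding N_def v(1) by (intro imageI) auto
  qed
  moreover have "inverse ((inverse \<epsilon> + 2 ^ (2 * d)) * real d) * real (card N) \<le> real (card L)"
  proof -
    have "card N = m" unfolding N_def using kQ by (rule card_multiples)
    moreover have "card L = l" unfolding L_def using kQ by (intro card_multiples) (simp add: q_def)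
    ultimately show ?thesis using l(3) by (simp add: \<kappa>_def)
  qed
  moreover have "square_integrable M (\<lambda>\<omega>. component p \<omega> - Z p \<omega>) \<and>
      L2_norm M (\<lambda>\<omega>. component p \<omega> - Z p \<omega>) \<le> 2 ^ ((d + 2) choose 2) * sqrt (2 * \<epsilon>)"
    if Z: "real_process M (part_incr {1..d} N) Z" "decomposition M d N X Z" "approx_orthogonal M d N \<epsilon> Z"
      and p: "p \<in> part_incr {1..d} L" for Z p
  proof -
    have \<epsilon>0: "0 \<le> \<epsilon>" using \<epsilon> by simp
    have D1: "approx_decomposition M d N X component \<epsilon>"
      using approx_decompositionI[OF \<epsilon>0 Nsub real_process_component decomposition_component approx_orthogonal_component[OF ortho]] .
    have D2: "approx_decomposition M d N X Z \<epsilon>"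
      using approx_decompositionI[OF \<epsilon>0 Nsub Z] .
    have Rq: "R * d < q" by (simp add: q_def)
    note uniq = approx_decomposition_unique[OF D1 D2 kQ d_pos l(1) R(1) Rq L_def fill_N p]
    have "(1 + 4 ^ d * \<epsilon>) / R \<le> 4 ^ d * \<epsilon>"
    proof -
      have "1 + 4 ^ d * \<epsilon> = \<epsilon> * \<kappa>" unfolding \<kappa>_def pow using \<epsilon> by (simp add: distrib_left)
      also have "\<dots> \<le> \<epsilon> * (4 * R)" using R(2) \<epsilon> by (intro mult_left_mono) auto
      also have "\<dots> \<le> (4 ^ d * \<epsilon>) * R"
        using mult_right_mono[OF four, of "\<epsilon> * R"] \<epsilon> by (simp add: algebra_simps)
      finally show ?thesis using R(1) by (simp add: pos_divide_le_eq)
    qed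
    then have "(4::real) ^ d * (4 * ((1 + 4 ^ d * \<epsilon>) / R + 4 ^ d * \<epsilon>)) \<le> 4 ^ d * (4 * (4 ^ d * \<epsilon> + 4 ^ d * \<epsilon>))"
      by (intro mult_left_mono add_right_mono) auto
    also have "\<dots> = 8 * (4 ^ d * 4 ^ d) * \<epsilon>" by simp
    also have "(4::real) ^ d * 4 ^ d = 16 ^ d" by (simp flip: power_mult_distrib)
    finally have "L2_inner M (\<lambda>\<omega>. component p \<omega> - Z p \<omega>) (\<lambda>\<omega>. component p \<omega> - Z p \<omega>) \<le> 8 * 16 ^ d * \<epsilon>"
      using uniq(2) by linarith
    then show ?thesis using uniq(1) L2_norm_bound[OF d_pos \<epsilon>0] by blast
  qed
  ultimately show ?thesis
    unfolding has_decomposition_def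
    using real_process_component decomposition_component approx_zero_mean_component[of \<epsilon>] approx_orthogonal_component[OF ortho] \<epsilon>
    by (intro exI[of _ component] conjI exI[of _ L]) auto
qed

subsection \<open>Large error\<close>

text \<open>The component with domain \<open>{1..d}\<close> is the array itself and all others vanish.  Uniqueness only needs
that each component of a competitor has norm at most \<open>\<surd>(1 + 4 ^ d * \<epsilon>)\<close>, provided it is a restriction of
some total map; for this the elements of \<open>L\<close> are multiples of \<open>d\<close> that leave \<open>d - 1\<close> integers above the last one.\<close>

lemma (in unit_spreadable_array) has_decomposition_large:
  assumes \<epsilon>: "1 < \<epsilon>" and n: "2 * d - 1 \<le> n"
  shows "has_decomposition M d {1..n} X \<epsilon>"
proof -
  define \<Delta> :: "(nat \<rightharpoonup> nat) \<Rightarrow> 'a \<Rightarrow> real"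
    where "\<Delta> p = (if dom p = {1..d} then X (ran p) else (\<lambda>_. 0))" for p
  have ran_as_map: "ran (as_map d f) = f ` {1..d}" for f
    by (auto simp: ran_def as_map_def)
  have \<epsilon>0: "0 \<le> \<epsilon>" using \<epsilon> by simp
  have \<Delta>: "square_integrable M (\<Delta> p) \<and> L2_inner M (\<Delta> p) (\<Delta> p) \<le> 1" if p: "p \<in> part_incr {1..d} {1..n}" for p
  proof (cases "dom p = {1..d}")
    case True
    have "incr d {1..n} (\<lambda>i. the (p i))"
      unfolding incr_def using p True part_incr_val[OF p] part_incr_less[OF p]
      by (auto intro!: strict_mono_onI)
    moreover have "p = as_map d (\<lambda>i. the (p i))"
    proof
      fix i
      show "p i = as_map d (\<lambda>i. the (p i)) i"
      proof (cases "p i")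
        case None
        then have "i \<notin> {1..d}" using True by blast
        then show ?thesis using None by (simp add: as_map_def)
      next
        case (Some y)
        then have "i \<in> {1..d}" using True by blast
        then show ?thesis using Some by (simp add: as_map_def)
      qed
    qed
    then have "ran p = (\<lambda>i. the (p i)) ` {1..d}" by (metis ran_as_map)
    ultimately have "ran p \<in> nsets {1..n} d" using incr_nsets by metis
    then show ?thesis using True square_integrable_X norm_X by (simp add: \<Delta>_def)
  next
    case False
    then show ?thesis by (simp add: \<Delta>_def square_integrable_def L2_inner_def)
  qed
  have L2_inner_le: "\<bar>L2_inner M f g\<bar> \<le> \<epsilon>"
    if "square_integrable M f \<and> L2_inner M f f \<le> 1" "square_integrable M g \<and> L2_inner M g g \<le> 1" for f g
    using abs_L2_inner_le[of M f g 1] that \<epsilon> by auto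
  have proc: "real_process M (part_incr {1..d} {1..n}) \<Delta>"
    using \<Delta> by (auto simp: real_process_def square_integrable_def)
  have dec: "decomposition M d {1..n} X \<Delta>"
    unfolding decomposition_def
  proof (intro ballI AE_I2)
    fix s \<omega> assume "s \<in> nsets {1..n} d"
    then obtain f where f: "incr d {1..n} f" "s = f ` {1..d}" by (rule nsets_incr)
    have "(\<Sum>F\<in>Pow {1..d}. \<Delta> (as_map d f |` F) \<omega>) = (\<Sum>F\<in>Pow {1..d}. if F = {1..d} then X s \<omega> else 0)"
    proof (rule sum.cong[OF refl])
      fix F assume "F \<in> Pow {1..d}"
      then have "dom (as_map d f |` F) = F" by (auto simp: dom_as_map_restrict)
      moreover have "as_map d f |` {1..d} = as_map d f" by (auto simp: fun_eq_iff restrict_map_def as_map_def)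
      ultimately show "\<Delta> (as_map d f |` F) \<omega> = (if F = {1..d} then X s \<omega> else 0)"
        using f(2) by (auto simp: \<Delta>_def ran_as_map)
    qed
    then show "X s \<omega> = (\<Sum>F\<in>Pow {1..d}. \<Delta> (canon_iso s |` F) \<omega>)"
      using canon_iso_image[OF f(1)] f(2) by simp
  qed
  have mean: "approx_zero_mean M d {1..n} \<epsilon> \<Delta>"
    unfolding approx_zero_mean_def
  proof (intro ballI impI conjI)
    fix p assume p: "p \<in> part_incr {1..d} {1..n}"
    show "integrable M (\<Delta> p)" using \<Delta>[OF p] by (intro square_integrable_integrable) blast
    have "\<bar>L2_inner M (\<Delta> p) (\<lambda>_. 1)\<bar> \<le> \<epsilon>"
      using \<Delta>[OF p] by (intro L2_inner_le) (auto simp: square_integrable_def L2_inner_def prob_space)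
    then show "\<bar>\<integral>\<omega>. \<Delta> p \<omega> \<partial>M\<bar> \<le> \<epsilon>" by (simp add: L2_inner_def)
  qed
  have orth: "approx_orthogonal M d {1..n} \<epsilon> \<Delta>"
    unfolding approx_orthogonal_def
  proof (intro ballI impI conjI)
    fix p q assume p: "p \<in> part_incr {1..d} {1..n}" and q: "q \<in> part_incr {1..d} {1..n}"
    show "integrable M (\<lambda>\<omega>. \<Delta> p \<omega> * \<Delta> q \<omega>)"
      using \<Delta>[OF p] \<Delta>[OF q] by (intro square_integrable_mult) auto
    show "\<bar>\<integral>\<omega>. \<Delta> p \<omega> * \<Delta> q \<omega> \<partial>M\<bar> \<le> \<epsilon>" using L2_inner_le[OF \<Delta>[OF p] \<Delta>[OF q]] by (simp add: L2_inner_def)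
  qed
  define a where "a = (n + 1) div d"
  define L where "L = (*) (1 * d) ` {1..a - 1}"
  have "d * a + (n + 1) mod d = n + 1" by (simp add: a_def)
  moreover have "(n + 1) mod d < d" using d_pos by simp
  moreover have "d * (a + 1) = d * a + d" by (simp only: distrib_left mult_1_right)
  ultimately have da: "d * a \<le> n + 1" "n + 1 < d * (a + 1)" by linarith+
  have a2: "2 \<le> a" unfolding a_def using n d_pos by (simp add: less_eq_div_iff_mult_less_eq)
  have ada: "(a - 1) * d + d = d * a" using a2 by (cases a) (auto simp: algebra_simps)
  have "L \<subseteq> {1..n}"
  proof
    fix x assume "x \<in> L"
    then obtain v where "x = 1 * d * v" "v \<in> {1..a - 1}" unfolding L_def by (rule imageE)
    then have v: "x = d * v" "1 \<le> v" "v \<le> a - 1" by simp_all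
    have "d * v \<le> d * (a - 1)" using v(3) by (rule mult_le_mono2)
    then have "d * v \<le> n" using mult.commute[of d "a - 1"] d_pos ada da(1) by linarith
    moreover have "1 \<le> d * v" using v(2) d_pos by (simp add: Suc_le_eq One_nat_def)
    ultimately show "x \<in> {1..n}" using v(1) by simp
  qed
  moreover have "inverse ((inverse \<epsilon> + 2 ^ (2 * d)) * real d) * real (card {1..n}) \<le> real (card L)"
  proof -
    have "card L = a - 1" unfolding L_def using d_pos by (intro card_multiples) simp
    have d0: "0 < real d" using d_pos by simp
    have "(2::real) ^ 2 \<le> 2 ^ (2 * d)" using d_pos by (intro power_increasing) auto
    then have "4 \<le> inverse \<epsilon> + 2 ^ (2 * d)" using \<epsilon> by (simp add: add_increasing)
    then have "inverse ((inverse \<epsilon> + 2 ^ (2 * d)) * real d) \<le> inverse (4 * real d)"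
      using d0 by (intro le_imp_inverse_le mult_right_mono) auto
    then have "inverse ((inverse \<epsilon> + 2 ^ (2 * d)) * real d) * real n \<le> inverse (4 * real d) * real n"
      by (rule mult_right_mono) simp
    also have "\<dots> \<le> inverse (4 * real d) * (real d * (real a + 1))"
    proof (rule mult_left_mono)
      have "n \<le> d * (a + 1)" using da(2) by simp
      then have "real n \<le> real (d * (a + 1))" by (rule of_nat_mono)
      then show "real n \<le> real d * (real a + 1)" by simp
    qed (use d0 in simp)
    also have "\<dots> = (real a + 1) / 4" using d0 by (simp add: field_simps)
    also have "\<dots> \<le> real (a - 1)" using a2 by (simp add: of_nat_diff)
    finally show ?thesis using \<open>card L = a - 1\<close> by simp
  qed
  moreover have "square_integrable M (\<lambda>\<omega>. \<Delta> p \<omega> - Z p \<omega>) \<and>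
      L2_norm M (\<lambda>\<omega>. \<Delta> p \<omega> - Z p \<omega>) \<le> 2 ^ ((d + 2) choose 2) * sqrt (2 * \<epsilon>)"
    if Z: "real_process M (part_incr {1..d} {1..n}) Z" "decomposition M d {1..n} X Z"
        "approx_orthogonal M d {1..n} \<epsilon> Z"
      and p: "p \<in> part_incr {1..d} L" for Z p
  proof -
    let ?f = "fill d 1 p 0"
    have "(*) 1 ` {1..(a - 1) * d + 1 * d - 1} \<subseteq> {1..n}" using ada da(1) by auto
    moreover have "incr d ((*) 1 ` {1..(a - 1) * d + 1 * d - 1}) ?f"
      using p a2 d_pos unfolding L_def by (intro fill_incr) auto
    ultimately have f: "incr d {1..n} ?f" by (rule incr_mono[rotated])
    have pf: "as_map d ?f |` dom p = p" using p by (rule as_map_fill_restrict)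
    have dom: "dom p \<in> Pow {1..d}" using part_incr_dom[OF p] by blast
    have bound: "square_integrable M (W p) \<and> L2_inner M (W p) (W p) \<le> 1 + 4 ^ d * \<epsilon>"
      if W: "approx_decomposition M d {1..n} X W \<epsilon>" for W
    proof -
      interpret W: approx_decomposition M d "{1..n}" X W \<epsilon> by (rule W)
      have "L2_inner M (W (as_map d ?f |` dom p)) (W (as_map d ?f |` dom p))
          \<le> (\<Sum>F\<in>Pow {1..d}. L2_inner M (W (as_map d ?f |` F)) (W (as_map d ?f |` F)))"
        using dom by (intro member_le_sum) (auto simp: L2_inner_self_nonneg)
      then show ?thesis
        using W.sum_norms_le[OF f] W.square_integrable_Z_as_map[OF f dom] unfolding pf by linarith
    qed
    have b1: "square_integrable M (\<Delta> p) \<and> L2_inner M (\<Delta> p) (\<Delta> p) \<le> 1 + 4 ^ d * \<epsilon>"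
      by (intro bound approx_decompositionI \<epsilon>0 proc dec orth order.refl)
    have b2: "square_integrable M (Z p) \<and> L2_inner M (Z p) (Z p) \<le> 1 + 4 ^ d * \<epsilon>"
      by (intro bound approx_decompositionI \<epsilon>0 Z order.refl)
    have "L2_inner M (\<lambda>\<omega>. \<Delta> p \<omega> - Z p \<omega>) (\<lambda>\<omega>. \<Delta> p \<omega> - Z p \<omega>) \<le> 2 * (L2_inner M (\<Delta> p) (\<Delta> p) + L2_inner M (Z p) (Z p))"
      using b1 b2 by (intro L2_inner_diff_self_le) auto
    also have "\<dots> \<le> 2 * ((1 + 4 ^ d * \<epsilon>) + (1 + 4 ^ d * \<epsilon>))"
      using b1 b2 by (intro mult_left_mono add_mono) auto
    also have "\<dots> = 4 * (1 + 4 ^ d * \<epsilon>)" by simp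
    also have "\<dots> \<le> 4 * (2 * (16 ^ d * \<epsilon>))"
    proof -
      have "1 * 1 \<le> 16 ^ d * \<epsilon>" using \<epsilon> by (intro mult_mono) (auto intro: one_le_power)
      then have "1 \<le> 16 ^ d * \<epsilon>" by simp
      moreover have "4 ^ d * \<epsilon> \<le> 16 ^ d * \<epsilon>" using \<epsilon>0 by (intro mult_right_mono power_mono) auto
      ultimately have "1 + 4 ^ d * \<epsilon> \<le> 16 ^ d * \<epsilon> + 16 ^ d * \<epsilon>" by (rule add_mono)
      then have "1 + 4 ^ d * \<epsilon> \<le> 2 * (16 ^ d * \<epsilon>)" by (simp only: mult_2)
      then show ?thesis by (rule mult_left_mono) simp
    qed
    finally have "L2_inner M (\<lambda>\<omega>. \<Delta> p \<omega> - Z p \<omega>) (\<lambda>\<omega>. \<Delta> p \<omega> - Z p \<omega>) \<le> 8 * 16 ^ d * \<epsilon>" by simp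
    then show ?thesis
      using L2_norm_bound[OF d_pos \<epsilon>0] square_integrable_diff b1 b2 by blast
  qed
  ultimately show ?thesis
    unfolding has_decomposition_def using proc dec mean orth
    by (intro exI[of _ \<Delta>] conjI exI[of _ L]) auto
qed

theorem theorem1p7:
  fixes d n :: nat and \<epsilon> :: real
  assumes "d \<ge> 1" and "\<epsilon> > 0" and "real n \<ge> n0_const d \<epsilon>"
    and "\<epsilon> > 1 \<Longrightarrow> c_const d \<epsilon> * root (d + 1) (real n) \<le> real n \<and> 2 * d - 1 \<le> n"
  shows "\<exists>N \<subseteq> {1..n}. real (card N) \<ge> c_const d \<epsilon> * root (d + 1) (real n) \<and>
    (\<forall>(M :: 'a measure) X.
       prob_space M \<and> random_array M d {1..n} X \<and> spreadable M d {1..n} X \<and>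
       (\<forall>s\<in>nsets {1..n} d. square_integrable M (X s) \<and> L2_norm M (X s) = 1) \<longrightarrow>
       (\<exists>\<Delta>. real_process M (part_incr {1..d} N) \<Delta> \<and>
          decomposition M d N X \<Delta> \<and>
          approx_zero_mean M d N \<epsilon> \<Delta> \<and>
          approx_orthogonal M d N \<epsilon> \<Delta> \<and>
          (\<exists>L \<subseteq> N. real (card L) \<ge> inverse ((inverse \<epsilon> + 2 ^ (2 * d)) * real d) * real (card N) \<and>
             (\<forall>Z. real_process M (part_incr {1..d} N) Z \<and>
                decomposition M d N X Z \<and> approx_orthogonal M d N \<epsilon> Z \<longrightarrow>
                (\<forall>p\<in>part_incr {1..d} L.
                   square_integrable M (\<lambda>\<omega>. \<Delta> p \<omega> - Z p \<omega>) \<and>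
                   L2_norm M (\<lambda>\<omega>. \<Delta> p \<omega> - Z p \<omega>) \<le> 2 ^ ((d + 2) choose 2) * sqrt (2 * \<epsilon>))))))"
proof -
  have "\<exists>N \<subseteq> {1..n}. real (card N) \<ge> c_const d \<epsilon> * root (d + 1) (real n) \<and>
      (\<forall>(M :: 'a measure) X. unit_spreadable_array M d n X \<longrightarrow> has_decomposition M d N X \<epsilon>)"
  proof (cases "\<epsilon> \<le> 1")
    case True
    from parameters_exist[OF assms(1,2) True assms(3)] obtain k m :: nat
      where km: "k > 0" "4 ^ d * (4 * real d / sqrt k) \<le> \<epsilon>" "k * (k * d + 1) * (m + 1) \<le> n"
        "c_const d \<epsilon> * root (d + 1) (real n) \<le> m" "2 ^ (20 * d + 4) / \<epsilon> \<le> m" .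
    let ?Q = "k * d + 1"
    define S where "S = (*) (k * ?Q) ` {1..m}"
    have kQ: "0 < k * ?Q" using km(1) by simp
    have "0 < 2 ^ (20 * d + 4) / \<epsilon>" using assms(2) by simp
    then have m: "1 \<le> m" using km(5) by (cases m) auto
    have "S \<subseteq> {1..n}"
    proof
      fix x assume "x \<in> S"
      then obtain v where "x = k * ?Q * v" "v \<in> {1..m}" unfolding S_def by (rule imageE)
      then have v: "x = k * ?Q * v" "1 \<le> v" "v \<le> m" by simp_all
      have "x \<le> k * ?Q * (m + 1)" unfolding v(1) using v(3) by (intro mult_le_mono2) simp
      moreover have "1 \<le> x" unfolding v(1) using v(2) kQ by (simp only: Suc_le_eq One_nat_def nat_0_less_mult_iff)
      ultimately show "x \<in> {1..n}" using km(3) by simp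
    qed
    moreover have "card S = m" unfolding S_def using kQ by (rule card_multiples)
    moreover have "has_decomposition M d S X \<epsilon>" if "unit_spreadable_array M d n X" for M :: "'a measure" and X
    proof -
      interpret sparse_array M d n X k ?Q m
        using that km(1,3) m by (intro sparse_array.intro sparse_array_axioms.intro) auto
      have "has_decomposition M d ((*) (k * ?Q) ` {1..m}) X \<epsilon>"
        using has_decomposition_N[OF assms(2) True km(2,5)] by (simp only: N_def)
      then show ?thesis by (simp only: S_def)
    qed
    ultimately show ?thesis using km(4) by (intro exI[of _ S]) simp
  next
    case False
    then show ?thesis
      using assms(4) unit_spreadable_array.has_decomposition_large[of _ d n _ \<epsilon>]
      by (intro exI[of _ "{1..n}"]) auto
  qed
  then obtain N where N: "N \<subseteq> {1..n}" "real (card N) \<ge> c_const d \<epsilon> * root (d + 1) (real n)"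
    "\<forall>(M :: 'a measure) X. unit_spreadable_array M d n X \<longrightarrow> has_decomposition M d N X \<epsilon>"
    by (elim exE conjE) (rule that)
  show ?thesis
  proof (rule exI[of _ N], intro conjI allI impI, goal_cases)
    case (3 M X)
    then have "has_decomposition M d N X \<epsilon>"
      by (intro N(3)[rule_format] unit_spreadable_arrayI assms(1)) simp_all
    then show ?case by (simp only: has_decomposition_def)
  qed (rule N(1), rule N(2))
qed

end
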